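(* Let $X$ be a Banach space, let $\mu\in\mathcal{A}_\infty$, and let $\mathcal{U}=\{U(t,s)\}_{t\ge s}$ be an evolution family on $X$ for which there are constants $\alpha>0$, $K\ge 1$ with $\|U(s,\tau)\|\le Ke^{\alpha(\mu(s)-\mu(\tau))}$ for all $s\ge\tau$. Let $G$ be the generator of the generalized evolution semigroup $\{T_t\}_{t\ge 0}$ on $C_0(\mathbb{R},X)$, $$T_tu(s)=U(s,\mu^{-1}(\mu(s)-t))\,u(\mu^{-1}(\mu(s)-t)),\quad t\ge 0,\ s\in\mathbb{R}.$$ Then the spectrum $\sigma(T_t)$ is rotationally invariant for $t>0$ (i.e. $\lambda\sigma(T_t)=\sigma(T_t)$ for every $\lambda\in\mathbb{C}$ with $|\lambda|=1$), and the spectrum $\sigma(G)$ is invariant under translations along the imaginary axis (i.e. $\sigma(G)=\sigma(G)+i\mathbb{R}$). Furthermore, the generalized evolution semigroup satisfies the spectral mapping theorem $$\sigma(T_t)\setminus\{0\}=e^{t\sigma(G)}\quad\text{for } t\ge 0,$$ and, consequently, the following statements are equivalent: (1) $\sigma(T_t)\cap\mathbb{T}=\emptyset$ for some $t>0$, and thus for all $t>0$; (2) $0\in\varrho(G)$, that is, $G:D(G)\subseteq C_0(\mathbb{R},X)\to C_0(\mathbb{R},X)$ is invertible.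
   Context: $\mathcal{A}_\infty$ is the set of continuous, strictly increasing functions $\mu:\mathbb{R}\to\mathbb{R}$ with $\lim_{s\to-\infty}\mu(s)=-\infty$ and $\lim_{s\to+\infty}\mu(s)=+\infty$. A (strongly continuous) evolution family on $X$ is a collection of bounded linear operators $U(t,s)$, $t\ge s$ in $\mathbb{R}$, on $X$ such that $U(t,t)=\mathrm{Id}$ for all $t$; $U(t,\tau)U(\tau,t_0)=U(t,t_0)$ for $t\ge\tau\ge t_0$; and for each $x\in X$ the map $(t,s)\mapsto U(t,s)x$ is continuous on $\{(t,s)\in\mathbb{R}^2: t\ge s\}$. $C_0(\mathbb{R},X)$ is the Banach space of continuous functions $u:\mathbb{R}\to X$ with $\lim_{|s|\to\infty}u(s)=0$, with the sup-norm. Under the stated hypotheses $\{T_t\}_{t\ge 0}$ is a $C_0$-semigroup on $C_0(\mathbb{R},X)$. $\sigma(\cdot)$ denotes the spectrum, $\varrho(\cdot)$ the resolvent set, $\mathbb{T}=\{\lambda\in\mathbb{C}:|\lambda|=1\}$, and $e^{t\sigma(G)}=\{e^{t\lambda}:\lambda\in\sigma(G)\}$.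
   Formalization: At t = 0 the spectral mapping identity is claimed only when σ(G) is nonempty, since it fails otherwise: for X = ℂ, μ = id, U(t,s) = exp(−(t³−s³)) one has σ(G) = ∅ but σ(T_0) = {1}; for all t > 0 it is unrestricted. *)

theory Defs
  imports "HOL-Analysis.Analysis"
begin

section \<open>Complex Banach spaces\<close>

class complex_normed_vector = real_normed_vector +
  fixes scaleC :: "complex \<Rightarrow> 'a \<Rightarrow> 'a" (infixr "*\<^sub>C" 75)
  assumes scaleC_add_right: "c *\<^sub>C (x + y) = c *\<^sub>C x + c *\<^sub>C y"
    and scaleC_add_left: "(c + d) *\<^sub>C x = c *\<^sub>C x + d *\<^sub>C x"
    and scaleC_scaleC: "c *\<^sub>C (d *\<^sub>C x) = (c * d) *\<^sub>C x"
    and scaleC_one: "1 *\<^sub>C x = x"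
    and scaleC_of_real: "complex_of_real r *\<^sub>C x = r *\<^sub>R x"
    and norm_scaleC: "norm (c *\<^sub>C x) = cmod c * norm x"

class complex_banach = complex_normed_vector + complete_space

subclass (in complex_banach) banach ..

instantiation complex :: complex_banach
begin
definition scaleC_complex :: "complex \<Rightarrow> complex \<Rightarrow> complex" where
  "scaleC_complex c x = c * x"
instance
  by standard (auto simp: scaleC_complex_def algebra_simps norm_mult scaleR_conv_of_real)
end

definition bounded_clinear ::
    "('a::complex_normed_vector \<Rightarrow> 'b::complex_normed_vector) \<Rightarrow> bool" where
  "bounded_clinear f \<longleftrightarrow> bounded_linear f \<and> (\<forall>c x. f (c *\<^sub>C x) = c *\<^sub>C f x)"


section \<open>Resolvent set and spectrum\<close>

text \<open>A possibly unbounded operator is given by its domain \<open>D\<close> and a function \<open>A\<close>, whose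
  values outside \<open>D\<close> are irrelevant; for an everywhere defined operator take \<open>D = UNIV\<close>.\<close>

definition resolvent_set ::
    "'a::complex_normed_vector set \<Rightarrow> ('a \<Rightarrow> 'a) \<Rightarrow> complex set" where
  "resolvent_set D A = {z. \<exists>R. bounded_clinear R \<and>
     (\<forall>y. R y \<in> D \<and> z *\<^sub>C R y - A (R y) = y) \<and>
     (\<forall>x\<in>D. R (z *\<^sub>C x - A x) = x)}"

definition spectrum ::
    "'a::complex_normed_vector set \<Rightarrow> ('a \<Rightarrow> 'a) \<Rightarrow> complex set" where
  "spectrum D A = - resolvent_set D A"


section \<open>Generator of an operator semigroup\<close>

definition generator_dom :: "(real \<Rightarrow> 'a \<Rightarrow> 'a::real_normed_vector) \<Rightarrow> 'a set" where
  "generator_dom T = {x. \<exists>y. ((\<lambda>h. (T h x - x) /\<^sub>R h) \<longlongrightarrow> y) (at_right 0)}"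

definition generator :: "(real \<Rightarrow> 'a \<Rightarrow> 'a::real_normed_vector) \<Rightarrow> 'a \<Rightarrow> 'a" where
  "generator T x = Lim (at_right 0) (\<lambda>h. (T h x - x) /\<^sub>R h)"


section \<open>The space \<open>C\<^sub>0(\<real>, X)\<close>\<close>

text \<open>On the reals, \<^term>\<open>at_infinity\<close> is the filter of \<open>\<bar>s\<bar> \<longlongrightarrow> \<infinity>\<close>.\<close>

typedef (overloaded) 'a c0 =
  "{u :: real \<Rightarrow> 'a::real_normed_vector. continuous_on UNIV u \<and> (u \<longlongrightarrow> 0) at_infinity}"
  morphisms apply_c0 Abs_c0
  by (rule exI[of _ "\<lambda>_. 0"]) auto

lemma c0_eqI: "(\<And>s. apply_c0 u s = apply_c0 v s) \<Longrightarrow> u = v"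
  by (simp add: apply_c0_inject[symmetric] fun_eq_iff)

lemma c0_cont: "continuous_on UNIV (apply_c0 u)"
  and c0_lim: "(apply_c0 u \<longlongrightarrow> 0) at_infinity"
  using apply_c0[of u] by auto

lemma c0_bdd: "bdd_above (range (\<lambda>s. norm (apply_c0 u s)))"
proof -
  have "eventually (\<lambda>s. norm (apply_c0 u s) < 1) at_infinity"
    using tendstoD[OF c0_lim[of u], of 1] by simp
  then obtain b where b: "\<And>s. norm s \<ge> b \<Longrightarrow> norm (apply_c0 u s) < 1"
    by (auto simp: eventually_at_infinity)
  have "compact ((\<lambda>s. norm (apply_c0 u s)) ` {-b..b})"
    by (intro compact_continuous_image continuous_intros continuous_on_subset[OF c0_cont]) auto
  then obtain B where B: "\<And>s. s \<in> {-b..b} \<Longrightarrow> norm (apply_c0 u s) \<le> B"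
    by (force dest!: compact_imp_bounded simp: bounded_iff)
  have "norm (apply_c0 u s) \<le> max B 1" for s
  proof (cases "s \<in> {-b..b}")
    case True then show ?thesis using B[of s] by simp
  next
    case False
    then have "b \<le> norm s" by auto
    from b[OF this] show ?thesis by simp
  qed
  then show ?thesis by (auto simp: bdd_above_def)
qed

instantiation c0 :: (real_normed_vector) real_normed_vector
begin

definition zero_c0 :: "'a c0" where "0 = Abs_c0 (\<lambda>s. 0)"
definition plus_c0 :: "'a c0 \<Rightarrow> 'a c0 \<Rightarrow> 'a c0" where
  "u + v = Abs_c0 (\<lambda>s. apply_c0 u s + apply_c0 v s)"
definition minus_c0 :: "'a c0 \<Rightarrow> 'a c0 \<Rightarrow> 'a c0" where
  "u - v = Abs_c0 (\<lambda>s. apply_c0 u s - apply_c0 v s)"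
definition uminus_c0 :: "'a c0 \<Rightarrow> 'a c0" where
  "- u = Abs_c0 (\<lambda>s. - apply_c0 u s)"
definition scaleR_c0 :: "real \<Rightarrow> 'a c0 \<Rightarrow> 'a c0" where
  "r *\<^sub>R u = Abs_c0 (\<lambda>s. r *\<^sub>R apply_c0 u s)"
definition norm_c0 :: "'a c0 \<Rightarrow> real" where
  "norm u = (SUP s. norm (apply_c0 u s))"
definition dist_c0 :: "'a c0 \<Rightarrow> 'a c0 \<Rightarrow> real" where
  "dist_c0 u v = norm (u - v)"
definition sgn_c0 :: "'a c0 \<Rightarrow> 'a c0" where
  "sgn_c0 u = scaleR (inverse (norm u)) u"
definition uniformity_c0 :: "('a c0 \<times> 'a c0) filter" where
  "uniformity_c0 = (INF e\<in>{0<..}. principal {(u :: 'a c0, v). dist u v < e})"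
definition open_c0 :: "'a c0 set \<Rightarrow> bool" where
  "open_c0 S = (\<forall>u\<in>S. \<forall>\<^sub>F (u', v) in uniformity. u' = u \<longrightarrow> v \<in> S)"

lemma apply_c0_zero [simp]: "apply_c0 0 s = 0"
  unfolding zero_c0_def by (subst Abs_c0_inverse) auto

lemma apply_c0_plus [simp]: "apply_c0 (u + v) s = apply_c0 u s + apply_c0 v s"
  unfolding plus_c0_def using tendsto_add[OF c0_lim[of u] c0_lim[of v]]
  by (subst Abs_c0_inverse) (auto intro!: continuous_intros c0_cont)

lemma apply_c0_minus [simp]: "apply_c0 (u - v) s = apply_c0 u s - apply_c0 v s"
  unfolding minus_c0_def using tendsto_diff[OF c0_lim[of u] c0_lim[of v]]
  by (subst Abs_c0_inverse) (auto intro!: continuous_intros c0_cont)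

lemma apply_c0_uminus [simp]: "apply_c0 (- u) s = - apply_c0 u s"
  unfolding uminus_c0_def using tendsto_minus[OF c0_lim[of u]]
  by (subst Abs_c0_inverse) (auto intro!: continuous_intros c0_cont)

lemma apply_c0_scaleR [simp]: "apply_c0 (r *\<^sub>R u) s = r *\<^sub>R apply_c0 u s"
  unfolding scaleR_c0_def using tendsto_scaleR[OF tendsto_const c0_lim[of u], of r]
  by (subst Abs_c0_inverse) (auto intro!: continuous_intros c0_cont)

lemma norm_apply_c0_le: "norm (apply_c0 u s) \<le> norm u"
  unfolding norm_c0_def by (rule cSUP_upper[OF UNIV_I c0_bdd])

lemma norm_c0_le: "(\<And>s. norm (apply_c0 u s) \<le> B) \<Longrightarrow> norm u \<le> B"
  unfolding norm_c0_def by (rule cSUP_least) auto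

instance
proof
  fix u v :: "'a c0" and r :: real
  show "norm u = 0 \<longleftrightarrow> u = 0"
  proof
    assume "norm u = 0"
    then have "apply_c0 u s = 0" for s using norm_apply_c0_le[of u s] by simp
    then show "u = 0" by (intro c0_eqI) simp
  next
    assume "u = 0" then show "norm u = 0" by (simp add: norm_c0_def)
  qed
  show "norm (u + v) \<le> norm u + norm v"
    by (rule norm_c0_le) (auto intro!: norm_triangle_le add_mono norm_apply_c0_le)
  have le: "norm (r *\<^sub>R u) \<le> \<bar>r\<bar> * norm u" for r and u :: "'a c0"
    by (rule norm_c0_le) (auto intro!: mult_left_mono norm_apply_c0_le)
  show "norm (r *\<^sub>R u) = \<bar>r\<bar> * norm u"
  proof (cases "r = 0")
    case True then show ?thesis by (simp add: norm_c0_def)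
  next
    case False
    then have "u = inverse r *\<^sub>R (r *\<^sub>R u)" by (intro c0_eqI) simp
    then have "norm u \<le> \<bar>inverse r\<bar> * norm (r *\<^sub>R u)" using le by metis
    then have "\<bar>r\<bar> * norm u \<le> norm (r *\<^sub>R u)" using False by (simp add: field_simps)
    with le[of r u] show ?thesis by simp
  qed
qed (auto intro!: c0_eqI simp: algebra_simps dist_c0_def sgn_c0_def uniformity_c0_def open_c0_def)

end

instance c0 :: (banach) banach
proof
  fix f :: "nat \<Rightarrow> 'a c0"
  assume C: "Cauchy f"
  have pt: "dist (apply_c0 u s) (apply_c0 v s) \<le> dist u v" for u v :: "'a c0" and s
    using norm_apply_c0_le[of "u - v" s] by (simp add: dist_norm)
  have "uniformly_Cauchy_on UNIV (\<lambda>n. apply_c0 (f n))"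
    unfolding uniformly_Cauchy_on_def
  proof (intro allI impI)
    fix e :: real assume "e > 0"
    then obtain M where "\<forall>m\<ge>M. \<forall>n\<ge>M. dist (f m) (f n) < e"
      using C unfolding Cauchy_def by blast
    then show "\<exists>M. \<forall>x\<in>UNIV. \<forall>m\<ge>M. \<forall>n\<ge>M. dist (apply_c0 (f m) x) (apply_c0 (f n) x) < e"
      using pt le_less_trans by blast
  qed
  then obtain g where g: "uniform_limit UNIV (\<lambda>n. apply_c0 (f n)) g sequentially"
    using Cauchy_uniformly_convergent uniformly_convergent_on_def by blast
  have "continuous_on UNIV g"
    by (rule uniform_limit_theorem[OF _ g]) (auto intro: c0_cont always_eventually)
  moreover have "(g \<longlongrightarrow> 0) at_infinity"
  proof (rule tendstoI)
    fix e :: real assume "e > 0"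
    then have "\<forall>\<^sub>F n in sequentially. \<forall>x\<in>UNIV. dist (apply_c0 (f n) x) (g x) < e/2"
      using uniform_limitD[OF g, of "e/2"] by simp
    then obtain n where n: "\<And>x. dist (apply_c0 (f n) x) (g x) < e/2"
      by (auto simp: eventually_sequentially)
    have "\<forall>\<^sub>F x in at_infinity. dist (apply_c0 (f n) x) 0 < e/2"
      using tendstoD[OF c0_lim, of "e/2"] \<open>e > 0\<close> by simp
    then show "\<forall>\<^sub>F x in at_infinity. dist (g x) 0 < e"
    proof eventually_elim
      case (elim x)
      then show ?case using n[of x] dist_triangle3[of "g x" 0 "apply_c0 (f n) x"] by simp
    qed
  qed
  ultimately have ag: "apply_c0 (Abs_c0 g) = g" by (simp add: Abs_c0_inverse)
  have "f \<longlonglongrightarrow> Abs_c0 g"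
  proof (rule tendstoI)
    fix e :: real assume "e > 0"
    then have "\<forall>\<^sub>F n in sequentially. \<forall>x\<in>UNIV. dist (apply_c0 (f n) x) (g x) < e/2"
      using uniform_limitD[OF g, of "e/2"] by simp
    then show "\<forall>\<^sub>F n in sequentially. dist (f n) (Abs_c0 g) < e"
    proof eventually_elim
      case (elim n)
      have "dist (f n) (Abs_c0 g) \<le> e/2"
        unfolding dist_norm
        by (rule norm_c0_le) (use elim in \<open>auto simp: ag dist_norm less_imp_le\<close>)
      then show ?case using \<open>e > 0\<close> by simp
    qed
  qed
  then show "convergent f" by (rule convergentI)
qed

instantiation c0 :: (complex_normed_vector) complex_normed_vector
begin

definition scaleC_c0 :: "complex \<Rightarrow> 'a c0 \<Rightarrow> 'a c0" where
  "c *\<^sub>C u = Abs_c0 (\<lambda>s. c *\<^sub>C apply_c0 u s)"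

lemma bounded_linear_scaleC: "bounded_linear (\<lambda>x::'a. c *\<^sub>C x)"
proof (rule bounded_linear_intro[of _ "cmod c"])
  fix x :: 'a and r :: real
  have "c *\<^sub>C r *\<^sub>R x = (c * complex_of_real r) *\<^sub>C x"
    by (simp only: scaleC_of_real[symmetric] scaleC_scaleC)
  also have "\<dots> = r *\<^sub>R c *\<^sub>C x"
    by (simp only: scaleC_of_real[symmetric] scaleC_scaleC mult.commute)
  finally show "c *\<^sub>C r *\<^sub>R x = r *\<^sub>R c *\<^sub>C x" .
qed (auto simp: scaleC_add_right norm_scaleC)

lemma apply_c0_scaleC [simp]: "apply_c0 (c *\<^sub>C u) s = c *\<^sub>C apply_c0 (u :: 'a c0) s"
  unfolding scaleC_c0_def
  using bounded_linear.tendsto[OF bounded_linear_scaleC c0_lim[of u], of c]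
    bounded_linear.continuous_on[OF bounded_linear_scaleC c0_cont[of u], of c]
  by (subst Abs_c0_inverse) (auto simp: bounded_linear.linear linear_0 bounded_linear_scaleC)

instance
proof
  fix c d :: complex and r :: real and u v :: "'a c0"
  show "c *\<^sub>C (u + v) = c *\<^sub>C u + c *\<^sub>C v" by (rule c0_eqI) (simp add: scaleC_add_right)
  show "(c + d) *\<^sub>C u = c *\<^sub>C u + d *\<^sub>C u" by (rule c0_eqI) (simp add: scaleC_add_left)
  show assoc: "c *\<^sub>C (d *\<^sub>C u) = (c * d) *\<^sub>C u" for c d and u :: "'a c0"
    by (rule c0_eqI) (simp add: scaleC_scaleC)
  show one: "1 *\<^sub>C u = u" for u :: "'a c0" by (rule c0_eqI) (simp add: scaleC_one)
  show "complex_of_real r *\<^sub>C u = r *\<^sub>R u" by (rule c0_eqI) (simp add: scaleC_of_real)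
  have le: "norm (c *\<^sub>C u) \<le> cmod c * norm u" for c and u :: "'a c0"
    by (rule norm_c0_le) (auto simp: norm_scaleC intro!: mult_left_mono norm_apply_c0_le)
  show "norm (c *\<^sub>C u) = cmod c * norm u"
  proof (cases "c = 0")
    case True
    then show ?thesis using le[of 0 u] by simp
  next
    case False
    have "norm u \<le> cmod (inverse c) * norm (c *\<^sub>C u)"
      using le[of "inverse c" "c *\<^sub>C u"] False by (simp add: assoc one)
    then have "cmod c * norm u \<le> cmod c * (cmod (inverse c) * norm (c *\<^sub>C u))"
      by (intro mult_left_mono) auto
    also have "\<dots> = norm (c *\<^sub>C u)" using False by (simp add: norm_inverse)
    finally have "cmod c * norm u \<le> norm (c *\<^sub>C u)" .
    with le[of c u] show ?thesis by simp
  qed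
qed

end

instance c0 :: (complex_banach) complex_banach ..


section \<open>Evolution families and generalized evolution semigroups\<close>

definition A_infinity :: "(real \<Rightarrow> real) set" where
  "A_infinity = {\<mu>. continuous_on UNIV \<mu> \<and> strict_mono \<mu> \<and>
     filterlim \<mu> at_bot at_bot \<and> filterlim \<mu> at_top at_top}"

text \<open>The values \<open>U t s\<close> with \<open>t < s\<close> are irrelevant.\<close>

definition evolution_family ::
    "(real \<Rightarrow> real \<Rightarrow> 'a::complex_normed_vector \<Rightarrow> 'a) \<Rightarrow> bool" where
  "evolution_family U \<longleftrightarrow>
     (\<forall>t s. s \<le> t \<longrightarrow> bounded_clinear (U t s)) \<and>
     (\<forall>t. U t t = id) \<and>
     (\<forall>t \<tau> t0. t0 \<le> \<tau> \<and> \<tau> \<le> t \<longrightarrow> U t \<tau> \<circ> U \<tau> t0 = U t t0) \<and>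
     (\<forall>x. continuous_on {(t, s). s \<le> t} (\<lambda>(t, s). U t s x))"

text \<open>\<^term>\<open>Abs_c0\<close> is unspecified outside \<open>C\<^sub>0\<close>; for an evolution family with
  \<open>\<parallel>U s \<tau>\<parallel> \<le> K * exp (\<alpha> * (\<mu> s - \<mu> \<tau>))\<close> the function below does lie in \<open>C\<^sub>0\<close> when
  \<open>t \<ge> 0\<close>, see \<open>apply_gen_evolution_semigroup\<close>.\<close>

definition gen_evolution_semigroup ::
    "(real \<Rightarrow> real \<Rightarrow> 'a::complex_normed_vector \<Rightarrow> 'a) \<Rightarrow> (real \<Rightarrow> real) \<Rightarrow>
     real \<Rightarrow> 'a c0 \<Rightarrow> 'a c0" where
  "gen_evolution_semigroup U \<mu> t u =
     Abs_c0 (\<lambda>s. U s (inv \<mu> (\<mu> s - t)) (apply_c0 u (inv \<mu> (\<mu> s - t))))"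

lemma A_infinity_bij:
  assumes "\<mu> \<in> A_infinity"
  shows "bij \<mu>"
proof -
  have c: "continuous_on UNIV \<mu>" and m: "strict_mono \<mu>"
    and bot: "filterlim \<mu> at_bot at_bot" and top: "filterlim \<mu> at_top at_top"
    using assms by (auto simp: A_infinity_def)
  have "\<exists>x. \<mu> x = y" for y
  proof -
    obtain a where a: "\<mu> a \<le> y"
      using bot[unfolded filterlim_at_bot, rule_format, of y]
      by (auto simp: eventually_at_bot_linorder)
    obtain b where b: "\<mu> b \<ge> y"
      using top[unfolded filterlim_at_top, rule_format, of y]
      by (auto simp: eventually_at_top_linorder)
    have "a \<le> b" using a b m by (meson order.trans strict_mono_less_eq)
    then show ?thesis
      using IVT'[of \<mu> a y b] a b continuous_on_subset[OF c] by auto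
  qed
  then show ?thesis using m by (metis bijI strict_mono_imp_inj_on surj_def)
qed

lemma apply_gen_evolution_semigroup:
  assumes \<mu>: "\<mu> \<in> A_infinity" and U: "evolution_family U"
    and bd: "\<forall>s \<tau>. \<tau> \<le> s \<longrightarrow> onorm (U s \<tau>) \<le> K * exp (\<alpha> * (\<mu> s - \<mu> \<tau>))"
    and t: "t \<ge> 0"
  shows "apply_c0 (gen_evolution_semigroup U \<mu> t u) s =
    U s (inv \<mu> (\<mu> s - t)) (apply_c0 u (inv \<mu> (\<mu> s - t)))"
proof -
  have c: "continuous_on UNIV \<mu>" and m: "strict_mono \<mu>"
    using \<mu> by (auto simp: A_infinity_def)
  have bij: "bij \<mu>" by (rule A_infinity_bij[OF \<mu>])
  have f1: "\<mu> (inv \<mu> x) = x" for x using bij by (simp add: bij_is_surj surj_f_inv_f)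
  have f2: "inv \<mu> (\<mu> x) = x" for x using bij by (simp add: bij_is_inj inv_f_f)
  have le: "inv \<mu> x \<le> y \<longleftrightarrow> x \<le> \<mu> y" for x y using m f1 by (metis strict_mono_less_eq)
  have ge: "y \<le> inv \<mu> x \<longleftrightarrow> \<mu> y \<le> x" for x y using m f1 by (metis strict_mono_less_eq)
  define g where "g s = inv \<mu> (\<mu> s - t)" for s
  have gs: "g s \<le> s" for s using t by (simp add: g_def le)
  have mug: "\<mu> s - \<mu> (g s) = t" for s by (simp add: g_def f1)
  define B where "B = K * exp (\<alpha> * t)"
  have blin: "bounded_linear (U s (g s))" for s
    using U gs by (auto simp: evolution_family_def bounded_clinear_def)
  have ub: "norm (U s (g s) x) \<le> B * norm x" for s x
  proof -
    have "norm (U s (g s) x) \<le> onorm (U s (g s)) * norm x" by (rule onorm[OF blin])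
    also have "onorm (U s (g s)) \<le> B" using bd[rule_format, OF gs[of s]] by (simp add: mug B_def)
    finally show ?thesis by (simp add: mult_right_mono)
  qed
  have ci: "continuous_on UNIV (inv \<mu>)"
  proof (rule continuous_at_imp_continuous_on, rule)
    fix x
    have "isCont (inv \<mu>) (\<mu> (inv \<mu> x))"
      by (rule isCont_inverse_function[of 1])
        (use c in \<open>auto simp: f2 continuous_on_eq_continuous_at\<close>)
    then show "isCont (inv \<mu>) x" by (simp add: f1)
  qed
  have cg: "continuous_on UNIV g"
    unfolding g_def by (intro continuous_intros continuous_on_compose2[OF ci] c) auto
  let ?w = "\<lambda>s. U s (g s) (apply_c0 u (g s))"
  have "isCont ?w a" for a
  proof -
    have "continuous_on UNIV (\<lambda>s. (\<lambda>(t, s). U t s (apply_c0 u (g a))) (s, g s))"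
      by (rule continuous_on_compose2[of "{(t, s). s \<le> t}"])
         (use U in \<open>auto simp: evolution_family_def gs intro!: continuous_intros cg\<close>)
    then have 1: "((\<lambda>s. U s (g s) (apply_c0 u (g a))) \<longlongrightarrow> ?w a) (at a)"
      by (simp add: continuous_on_def)
    have "continuous_on UNIV (\<lambda>s. apply_c0 u (g s))"
      by (rule continuous_on_compose2[OF c0_cont cg]) auto
    then have "((\<lambda>s. apply_c0 u (g s)) \<longlongrightarrow> apply_c0 u (g a)) (at a)"
      by (simp add: continuous_on_def)
    then have "((\<lambda>s. apply_c0 u (g s) - apply_c0 u (g a)) \<longlongrightarrow> 0) (at a)"
      using LIM_zero by blast
    then have 2: "((\<lambda>s. B * norm (apply_c0 u (g s) - apply_c0 u (g a))) \<longlongrightarrow> 0) (at a)"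
      using tendsto_mult_right_zero tendsto_norm_zero by blast
    have "((\<lambda>s. U s (g s) (apply_c0 u (g s) - apply_c0 u (g a))) \<longlongrightarrow> 0) (at a)"
      by (rule Lim_null_comparison[OF _ 2]) (auto simp: ub)
    from tendsto_add[OF this 1] show ?thesis
      by (simp add: isCont_def linear_diff[OF bounded_linear.linear[OF blin]])
  qed
  then have "continuous_on UNIV ?w" by (simp add: continuous_at_imp_continuous_on)
  moreover have "(?w \<longlongrightarrow> 0) at_infinity"
  proof -
    have "filterlim g at_infinity at_infinity"
      unfolding filterlim_at_infinity[OF order_refl]
    proof (intro allI impI)
      fix r :: real assume "r > 0"
      define b where "b = max \<bar>inv \<mu> (\<mu> r + t)\<bar> (\<bar>inv \<mu> (\<mu> (-r) + t)\<bar> + 1)"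
      have "r \<le> norm (g s)" if "b \<le> norm s" for s
      proof (cases "s \<ge> 0")
        case True
        then have "inv \<mu> (\<mu> r + t) \<le> s" using that by (auto simp: b_def)
        then have "r \<le> g s" by (simp add: le ge g_def)
        then show ?thesis by simp
      next
        case False
        then have "s \<le> inv \<mu> (\<mu> (-r) + t)" using that by (auto simp: b_def)
        then have "g s \<le> - r" by (simp add: le ge g_def)
        then show ?thesis by simp
      qed
      then show "\<forall>\<^sub>F s in at_infinity. r \<le> norm (g s)"
        by (auto simp: eventually_at_infinity)
    qed
    then have "((\<lambda>s. apply_c0 u (g s)) \<longlongrightarrow> 0) at_infinity"
      by (rule filterlim_compose[OF c0_lim])
    then have 2: "((\<lambda>s. B * norm (apply_c0 u (g s))) \<longlongrightarrow> 0) at_infinity"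
      using tendsto_mult_right_zero tendsto_norm_zero by blast
    show ?thesis by (rule Lim_null_comparison[OF _ 2]) (auto simp: ub)
  qed
  ultimately show ?thesis
    unfolding gen_evolution_semigroup_def g_def[symmetric] by (subst Abs_c0_inverse) auto
qed

end

theory Submission
  imports Defs
begin

text \<open>
  For every \<open>p > 0\<close>, the operator \<open>1 - T p\<close> is invertible iff the generator \<open>G\<close> is. If \<open>1 - T p\<close> is
  invertible, so is \<open>G\<close>, by \<open>G (\<integral>\<^sub>0\<^sup>p T r x dr) = T p x - x\<close>. Conversely, \<open>x - T p x = g\<close> only relates
  the values of \<open>x\<close> at points whose \<open>\<mu>\<close>-coordinates agree modulo \<open>p\<close>, and on each such class it
  reduces to one equation \<open>G u = - f\<close>, with \<open>f\<close> obtained by spreading the values of \<open>g\<close> along their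
  orbits.

  Multiplying \<open>U t s\<close> by \<open>exp (- w (\<mu> t - \<mu> s))\<close> replaces \<open>T t\<close> by \<open>exp (- w t) T t\<close> and \<open>G\<close> by \<open>G - w\<close>, so
  \<open>exp (p w)\<close> is in the resolvent set of \<open>T p\<close> iff \<open>w\<close> is in that of \<open>G\<close>. Hence \<open>\<sigma>(G)\<close> is invariant under
  translation by \<open>2 \<pi> \<i> / p\<close> for every \<open>p > 0\<close>, that is, along the whole imaginary axis, and the
  rotational invariance of \<open>\<sigma>(T p)\<close> follows.
\<close>

section \<open>Complex linear maps\<close>

lemma bounded_bilinear_scaleC:
  "bounded_bilinear (scaleC :: complex \<Rightarrow> 'a::complex_normed_vector \<Rightarrow> 'a)"
proof
  fix r :: real and a :: complex and b :: 'a
  show "(r *\<^sub>R a) *\<^sub>C b = r *\<^sub>R (a *\<^sub>C b)"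
    by (metis scaleC_of_real scaleC_scaleC scaleR_conv_of_real)
  show "a *\<^sub>C (r *\<^sub>R b) = r *\<^sub>R (a *\<^sub>C b)"
    by (simp add: scaleC_of_real[symmetric] scaleC_scaleC mult.commute)
  show "\<exists>K. \<forall>a b. norm (a *\<^sub>C b :: 'a) \<le> norm a * norm b * K"
    by (rule exI[of _ 1]) (simp add: norm_scaleC)
qed (simp_all add: scaleC_add_left scaleC_add_right)

lemmas tendsto_scaleC = bounded_bilinear.tendsto[OF bounded_bilinear_scaleC]
  and continuous_on_scaleC = bounded_bilinear.continuous_on[OF bounded_bilinear_scaleC]
  and scaleC_diff_right = bounded_bilinear.diff_right[OF bounded_bilinear_scaleC]
  and scaleC_diff_left = bounded_bilinear.diff_left[OF bounded_bilinear_scaleC]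
  and scaleC_zero_left = bounded_bilinear.zero_left[OF bounded_bilinear_scaleC]

lemma scaleC_scaleR: "c *\<^sub>C (r *\<^sub>R x) = r *\<^sub>R (c *\<^sub>C (x :: 'a::complex_normed_vector))"
  by (simp add: scaleC_of_real[symmetric] scaleC_scaleC mult.commute)

lemma bounded_clinearI:
  assumes add: "\<And>x y. f (x + y) = f x + f y" and scale: "\<And>c x. f (c *\<^sub>C x) = c *\<^sub>C f x"
    and bound: "\<And>x. norm (f x) \<le> B * norm x"
  shows "bounded_clinear f"
  unfolding bounded_clinear_def
proof
  show "bounded_linear f"
  proof (rule bounded_linear_intro)
    fix r :: real and x
    show "f (r *\<^sub>R x) = r *\<^sub>R f x"
      using scale[of "complex_of_real r" x] by (simp add: scaleC_of_real)
    show "norm (f x) \<le> norm x * B" using bound[of x] by (simp add: mult.commute)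
  qed (rule add)
qed (use scale in auto)

lemma bounded_clinear_imp_bounded_linear: "bounded_clinear f \<Longrightarrow> bounded_linear f"
  and bounded_clinear_scaleC: "bounded_clinear f \<Longrightarrow> f (c *\<^sub>C x) = c *\<^sub>C f x"
  by (simp_all add: bounded_clinear_def)

lemma bounded_clinear_compose:
  assumes "bounded_clinear f" "bounded_clinear g"
  shows "bounded_clinear (\<lambda>x. f (g x))"
  using assms bounded_linear_compose by (auto simp: bounded_clinear_def)

lemma bounded_clinear_const_scaleC:
  assumes "bounded_clinear f"
  shows "bounded_clinear (\<lambda>x. c *\<^sub>C f x)"
  using assms bounded_linear_compose[OF bounded_linear_scaleC]
  by (auto simp: bounded_clinear_def scaleC_scaleC mult.commute)

lemma bounded_clinear_id: "bounded_clinear (\<lambda>x. x)"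
  by (simp add: bounded_clinear_def)

text \<open>The quantitative form of surjectivity does the work of the open mapping theorem: a
  choice of preimages obeying the bound is, by injectivity, the inverse, hence linear and
  bounded.\<close>

lemma bounded_inverse_clinear:
  fixes A :: "'a::complex_normed_vector \<Rightarrow> 'b::complex_normed_vector"
  assumes A: "bounded_clinear A" and ker: "\<And>x. A x = 0 \<Longrightarrow> x = 0"
    and surj: "\<And>y. \<exists>x. A x = y \<and> norm x \<le> C * norm y"
  obtains R where "bounded_clinear R" "\<And>y. A (R y) = y" "\<And>x. R (A x) = x"
proof -
  have inj: "x = y" if "A x = A y" for x y
    using ker[of "x - y"] that by (simp add: linear_diff[OF bounded_linear.linear, OF bounded_clinear_imp_bounded_linear[OF A]])
  obtain R where R: "A (R y) = y" "norm (R y) \<le> C * norm y" for y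
    using surj by metis
  have "bounded_clinear R"
  proof (rule bounded_clinearI)
    show "R (x + y) = R x + R y" for x y
      by (rule inj) (simp add: R(1) linear_add[OF bounded_linear.linear[OF bounded_clinear_imp_bounded_linear[OF A]]])
    show "R (c *\<^sub>C x) = c *\<^sub>C R x" for c x
      by (rule inj) (simp add: R(1) bounded_clinear_scaleC[OF A])
  qed (rule R(2))
  then show thesis using that R(1) inj by blast
qed

section \<open>Spectrum and resolvent set\<close>

lemma resolvent_set_shift:
  fixes A :: "'a::complex_normed_vector \<Rightarrow> 'a"
  assumes "\<And>x. x \<in> D \<Longrightarrow> B x = A x - w *\<^sub>C x"
  shows "z \<in> resolvent_set D B \<longleftrightarrow> z + w \<in> resolvent_set D A"
proof -
  have "z *\<^sub>C x - B x = (z + w) *\<^sub>C x - A x" if "x \<in> D" for x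
    using assms[OF that] by (simp add: scaleC_add_left)
  then show ?thesis unfolding resolvent_set_def
    by (auto cong: conj_cong ball_cong simp: Ball_def)
qed

lemma resolvent_set_scale:
  fixes A :: "'a::complex_normed_vector \<Rightarrow> 'a"
  assumes "c \<noteq> 0"
  shows "c * z \<in> resolvent_set UNIV (\<lambda>x. c *\<^sub>C A x) \<longleftrightarrow> z \<in> resolvent_set UNIV A"
proof -
  \<comment> \<open>One implication for arbitrary \<open>c\<close> and \<open>A\<close> suffices:
    scaling back by \<open>inverse c\<close> gives the converse.\<close>
  have *: "c * z \<in> resolvent_set UNIV (\<lambda>x. c *\<^sub>C A x)"
    if z: "z \<in> resolvent_set UNIV A" and c: "c \<noteq> 0" for c z and A :: "'a \<Rightarrow> 'a"
  proof -
    obtain R where R: "bounded_clinear R" "\<And>y. z *\<^sub>C R y - A (R y) = y" "\<And>x. R (z *\<^sub>C x - A x) = x"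
      using z by (auto simp: resolvent_set_def)
    have e: "(c * z) *\<^sub>C x - c *\<^sub>C y = c *\<^sub>C (z *\<^sub>C x - y)" for x y :: 'a
      by (simp add: scaleC_diff_right scaleC_scaleC)
    have "bounded_clinear (\<lambda>y. R (inverse c *\<^sub>C y))"
      by (intro bounded_clinear_compose[OF R(1)] bounded_clinear_const_scaleC bounded_clinear_id)
    then show ?thesis using c
      by (auto simp: resolvent_set_def e R scaleC_scaleC scaleC_one
          intro!: exI[of _ "\<lambda>y. R (inverse c *\<^sub>C y)"])
  qed
  have "(\<lambda>x. inverse c *\<^sub>C c *\<^sub>C A x) = A" "inverse c * (c * z) = z"
    using assms by (auto simp: scaleC_scaleC scaleC_one)
  with *[OF _ assms] *[of "c * z" "\<lambda>x. c *\<^sub>C A x" "inverse c"] assms show ?thesis by auto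
qed

section \<open>Strongly continuous semigroups\<close>

lemma tendsto_at_right_transform:
  fixes f g :: "real \<Rightarrow> 'a::topological_space"
  assumes "(f \<longlongrightarrow> l) (at_right a)" "\<And>h. h > a \<Longrightarrow> f h = g h"
  shows "(g \<longlongrightarrow> l) (at_right a)"
  using assms(1) by (rule Lim_transform_eventually) (auto simp: eventually_at_filter assms(2))

text \<open>Translates derivatives of curves into the one-sided quotients that define the
  generator.\<close>

lemma has_vector_derivative_imp_right_quotient:
  assumes f: "(f has_vector_derivative y) (at a within {a..b})" and "a < b"
  shows "((\<lambda>h. (f (a + h) - f a) /\<^sub>R h) \<longlongrightarrow> y) (at_right 0)"
proof -
  have "((\<lambda>x. (f x - f a - (x - a) *\<^sub>R y) /\<^sub>R norm (x - a)) \<longlongrightarrow> 0) (at_right a)"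
    using f unfolding has_vector_derivative_def has_derivative_within at_within_Icc_at_right[OF \<open>a < b\<close>]
    by (simp add: diff_diff_add divide_inverse)
  then have "((\<lambda>h. (f (a + h) - f a - h *\<^sub>R y) /\<^sub>R norm h + y) \<longlongrightarrow> 0 + y) (at_right 0)"
    unfolding at_right_to_0[of a] filterlim_filtermap
    by (intro tendsto_add tendsto_const) (simp add: add.commute)
  then have "((\<lambda>h. (f (a + h) - f a - h *\<^sub>R y) /\<^sub>R norm h + y) \<longlongrightarrow> y) (at_right 0)"
    by simp
  then show ?thesis
    by (rule tendsto_at_right_transform) (simp add: scaleR_diff_right)
qed

lemma tendsto_generator:
  assumes "x \<in> generator_dom T"
  shows "((\<lambda>h. (T h x - x) /\<^sub>R h) \<longlongrightarrow> generator T x) (at_right 0)"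
proof -
  obtain y where y: "((\<lambda>h. (T h x - x) /\<^sub>R h) \<longlongrightarrow> y) (at_right 0)"
    using assms by (auto simp: generator_dom_def)
  then have "generator T x = y"
    unfolding generator_def by (intro tendsto_Lim) auto
  with y show ?thesis by simp
qed

lemma generatorI:
  assumes "((\<lambda>h. (T h x - x) /\<^sub>R h) \<longlongrightarrow> y) (at_right 0)"
  shows "x \<in> generator_dom T" "generator T x = y"
  using assms by (auto simp: generator_dom_def generator_def intro!: tendsto_Lim)

lemma generator_rescale:
  fixes T S :: "real \<Rightarrow> 'a::complex_normed_vector \<Rightarrow> 'a"
  assumes S: "\<And>t x. t \<ge> 0 \<Longrightarrow> S t x = exp (- (w * complex_of_real t)) *\<^sub>C T t x"
  shows "generator_dom S = generator_dom T"
    and "x \<in> generator_dom T \<Longrightarrow> generator S x = generator T x - w *\<^sub>C x"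
proof -
  \<comment> \<open>Product rule at 0. It is stated for arbitrary \<open>S\<close>,
    \<open>T\<close>, \<open>w\<close> because exchanging \<open>S\<close> and \<open>T\<close> and
    replacing \<open>w\<close> by \<open>- w\<close> yields the other inclusion of the
    domains.\<close>
  have *: "x \<in> generator_dom S \<and> generator S x = generator T x - w *\<^sub>C x"
    if S: "\<And>t x. t \<ge> 0 \<Longrightarrow> S t x = exp (- (w * complex_of_real t)) *\<^sub>C T t x"
      and x: "x \<in> generator_dom T"
    for T S :: "real \<Rightarrow> 'a \<Rightarrow> 'a" and w x
  proof -
    define E where "E h = exp (- (w * complex_of_real h))" for h
    have "((\<lambda>z. exp (- (w * z))) has_field_derivative - w) (at (complex_of_real 0))"
      by (auto intro!: derivative_eq_intros)
    then have "(E has_vector_derivative - w) (at 0)"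
      unfolding E_def by (rule has_vector_derivative_real_field)
    then have "(E has_vector_derivative - w) (at 0 within {0..1})"
      by (rule has_vector_derivative_at_within)
    from has_vector_derivative_imp_right_quotient[OF this]
    have D: "((\<lambda>h. (E h - 1) /\<^sub>R h) \<longlongrightarrow> - w) (at_right 0)"
      by (simp add: E_def)
    have C: "(E \<longlongrightarrow> 1) (at_right 0)"
      unfolding E_def by (auto intro!: tendsto_eq_intros)
    have "((\<lambda>h. E h *\<^sub>C ((T h x - x) /\<^sub>R h) + ((E h - 1) /\<^sub>R h) *\<^sub>C x)
        \<longlongrightarrow> 1 *\<^sub>C generator T x + (- w) *\<^sub>C x) (at_right 0)"
      by (intro tendsto_add tendsto_scaleC tendsto_generator x C D tendsto_const)
    moreover have "E h *\<^sub>C ((T h x - x) /\<^sub>R h) + ((E h - 1) /\<^sub>R h) *\<^sub>C x = (S h x - x) /\<^sub>R h"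
      if "h > 0" for h
    proof -
      have "((E h - 1) /\<^sub>R h) *\<^sub>C x = (E h *\<^sub>C x - x) /\<^sub>R h"
        by (simp add: bounded_bilinear.scaleR_left[OF bounded_bilinear_scaleC]
            scaleC_diff_left scaleC_one)
      then show ?thesis using that
        by (simp add: S E_def scaleC_scaleR scaleC_diff_right scaleR_diff_right)
    qed
    ultimately have "((\<lambda>h. (S h x - x) /\<^sub>R h) \<longlongrightarrow> 1 *\<^sub>C generator T x + (- w) *\<^sub>C x) (at_right 0)"
      by (rule tendsto_at_right_transform)
    from generatorI[of S x, OF this] show ?thesis
      by (simp add: scaleC_one bounded_bilinear.minus_left[OF bounded_bilinear_scaleC])
  qed
  have "T t x = exp (- (- w * complex_of_real t)) *\<^sub>C S t x" if "t \<ge> 0" for t x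
    using S[OF that] by (simp add: scaleC_scaleC scaleC_one flip: exp_add)
  then have **: "x \<in> generator_dom S \<Longrightarrow> x \<in> generator_dom T" for x
    using *[of T "- w" S x] by simp
  from ** *[of S w T, OF S] show "generator_dom S = generator_dom T"
    and "x \<in> generator_dom T \<Longrightarrow> generator S x = generator T x - w *\<^sub>C x" by auto
qed

section \<open>Integrals of orbits and the generator\<close>

locale c0_semigroup =
  fixes T :: "real \<Rightarrow> 'a::complex_banach \<Rightarrow> 'a" and M \<omega> :: real
  assumes zero: "T 0 x = x"
    and add: "s \<ge> 0 \<Longrightarrow> t \<ge> 0 \<Longrightarrow> T (s + t) x = T s (T t x)"
    and clinear: "t \<ge> 0 \<Longrightarrow> bounded_clinear (T t)"
    and bound: "t \<ge> 0 \<Longrightarrow> norm (T t x) \<le> M * exp (\<omega> * t) * norm x"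
    and cont: "continuous_on {0..} (\<lambda>t. T t x)"
begin

lemma blinear: "t \<ge> 0 \<Longrightarrow> bounded_linear (T t)"
  by (rule bounded_clinear_imp_bounded_linear[OF clinear])

lemma commute: "s \<ge> 0 \<Longrightarrow> t \<ge> 0 \<Longrightarrow> T s (T t x) = T t (T s x)"
  using add[of s t x] add[of t s x] by (simp add: add.commute)

lemma local_bound:
  assumes "a \<ge> 0"
  obtains B where "B > 0" "\<And>t x. 0 \<le> t \<Longrightarrow> t \<le> a \<Longrightarrow> norm (T t x) \<le> B * norm x"
proof
  \<comment> \<open>The absolute values make the bound monotone in \<open>t\<close> whatever the
    signs of \<open>M\<close> and \<open>\<omega>\<close>; the added 1 makes it strictly
    positive.\<close>
  show "\<bar>M\<bar> * exp (\<bar>\<omega>\<bar> * a) + 1 > 0" by (simp add: add_nonneg_pos)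
  fix t and x :: 'a assume t: "0 \<le> t" "t \<le> a"
  have "\<omega> * t \<le> \<bar>\<omega>\<bar> * a"
    using t by (intro mult_mono) auto
  then have "M * exp (\<omega> * t) \<le> \<bar>M\<bar> * exp (\<bar>\<omega>\<bar> * a)"
    by (intro mult_mono) auto
  then have "M * exp (\<omega> * t) * norm x \<le> (\<bar>M\<bar> * exp (\<bar>\<omega>\<bar> * a) + 1) * norm x"
    by (intro mult_right_mono) auto
  with bound[OF t(1)] show "norm (T t x) \<le> (\<bar>M\<bar> * exp (\<bar>\<omega>\<bar> * a) + 1) * norm x"
    by (rule order_trans)
qed

text \<open>The integrated semigroup; it maps every vector into the domain of the generator.\<close>

definition J :: "real \<Rightarrow> 'a \<Rightarrow> 'a" where "J a x = integral {0..a} (\<lambda>r. T r x)"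

lemma integrable: "0 \<le> a \<Longrightarrow> (\<lambda>r. T r x) integrable_on {a..b}"
  by (intro integrable_continuous_real continuous_on_subset[OF cont]) auto

lemma J_clinear:
  assumes "a \<ge> 0"
  shows "bounded_clinear (J a)"
proof -
  obtain B where B: "B > 0" "\<And>t x. 0 \<le> t \<Longrightarrow> t \<le> a \<Longrightarrow> norm (T t x) \<le> B * norm x"
    using local_bound[OF assms] by metis
  show ?thesis
  proof (rule bounded_clinearI)
    show "J a (x + y) = J a x + J a y" for x y
      unfolding J_def
      by (subst integral_add[symmetric])
        (auto intro!: integral_cong integrable simp: linear_add[OF bounded_linear.linear[OF blinear]])
    show "J a (c *\<^sub>C x) = c *\<^sub>C J a x" for c x
    proof -
      have "c *\<^sub>C J a x = integral {0..a} ((\<lambda>y. c *\<^sub>C y) \<circ> (\<lambda>r. T r x))"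
        unfolding J_def by (rule integral_linear[symmetric]) (auto intro: integrable bounded_linear_scaleC)
      also have "\<dots> = J a (c *\<^sub>C x)"
        unfolding J_def by (intro integral_cong) (simp add: bounded_clinear_scaleC[OF clinear])
      finally show ?thesis by simp
    qed
    show "norm (J a x) \<le> (B * a) * norm x" for x
    proof -
      have "norm (J a x) \<le> B * norm x * (a - 0)"
        unfolding J_def using assms B
        by (intro integral_bound) (auto intro: continuous_on_subset[OF cont])
      then show ?thesis by (simp add: mult_ac)
    qed
  qed
qed

lemma T_J: "h \<ge> 0 \<Longrightarrow> a \<ge> 0 \<Longrightarrow> T h (J a x) = integral {0..a} (\<lambda>r. T (h + r) x)"
proof -
  assume h: "h \<ge> 0" "a \<ge> 0"
  have "T h (J a x) = integral {0..a} (T h \<circ> (\<lambda>r. T r x))"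
    unfolding J_def by (rule integral_linear[symmetric]) (auto intro: integrable blinear h)
  also have "\<dots> = integral {0..a} (\<lambda>r. T (h + r) x)"
    by (intro integral_cong) (simp add: add h)
  finally show ?thesis .
qed

lemma T_J_commute: "h \<ge> 0 \<Longrightarrow> a \<ge> 0 \<Longrightarrow> T h (J a x) = J a (T h x)"
  by (subst T_J) (auto simp: J_def add commute intro!: integral_cong)

lemma J_add:
  assumes "h \<ge> 0" "a \<ge> 0"
  shows "J (a + h) x = J h x + T h (J a x)"
proof -
  have "T h (J a x) = integral {0..a} ((\<lambda>r. T r x) \<circ> (\<lambda>r. h + r))"
    using assms by (simp add: T_J o_def)
  also have "\<dots> = integral {0 + h..a + h} (\<lambda>r. T r x)"
    by (rule integral_shift_Icc_real)
  finally show ?thesis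
    using Henstock_Kurzweil_Integration.integral_combine[where a = 0 and c = h and b = "a + h" and f = "\<lambda>r. T r x"] assms by (simp add: J_def integrable)
qed

lemma J_right_derivative:
  assumes "a \<ge> 0"
  shows "((\<lambda>h. (J (a + h) x - J a x) /\<^sub>R h) \<longlongrightarrow> T a x) (at_right 0)"
proof -
  have "((\<lambda>u. J u x) has_vector_derivative T a x) (at a within {0..a+1})"
    unfolding J_def using assms
    by (intro integral_has_vector_derivative) (auto intro: continuous_on_subset[OF cont])
  then have "((\<lambda>u. J u x) has_vector_derivative T a x) (at a within {a..a+1})"
    by (rule has_vector_derivative_within_subset) (use assms in auto)
  from has_vector_derivative_imp_right_quotient[OF this] show ?thesis by simp
qed

text \<open>By \<open>J_add\<close>, \<open>T h (J a x) - J a x\<close> equals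
  \<open>(J (a + h) x - J a x) - J h x\<close>, so the quotient converges to the difference of the
  right derivatives of \<open>J\<close> at \<open>a\<close> and at 0.\<close>

lemma J_generator:
  assumes "a \<ge> 0"
  shows "J a x \<in> generator_dom T" "generator T (J a x) = T a x - x"
proof -
  have "((\<lambda>h. (J (a + h) x - J a x) /\<^sub>R h - (J (0 + h) x - J 0 x) /\<^sub>R h) \<longlongrightarrow> T a x - T 0 x) (at_right 0)"
    by (intro tendsto_diff J_right_derivative assms order_refl)
  moreover have "(J (a + h) x - J a x) /\<^sub>R h - (J (0 + h) x - J 0 x) /\<^sub>R h = (T h (J a x) - J a x) /\<^sub>R h"
    if "h > 0" for h
    using that assms by (simp add: J_add J_def[of 0] algebra_simps)
  ultimately have "((\<lambda>h. (T h (J a x) - J a x) /\<^sub>R h) \<longlongrightarrow> T a x - T 0 x) (at_right 0)"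
    by (rule tendsto_at_right_transform)
  from generatorI[of T "J a x", OF this] show "J a x \<in> generator_dom T" "generator T (J a x) = T a x - x"
    by (simp_all add: zero)
qed

text \<open>A bounded commuting operator passes through the difference quotient. It is applied to
  \<open>J a\<close> and to the inverse of \<open>1 - T a\<close>.\<close>

lemma bounded_commuting_generator:
  assumes R: "bounded_linear R" and comm: "\<And>h y. h \<ge> 0 \<Longrightarrow> T h (R y) = R (T h y)"
    and x: "x \<in> generator_dom T"
  shows "R x \<in> generator_dom T" "generator T (R x) = R (generator T x)"
proof -
  have "((\<lambda>h. R ((T h x - x) /\<^sub>R h)) \<longlongrightarrow> R (generator T x)) (at_right 0)"
    by (rule bounded_linear.tendsto[OF R tendsto_generator[OF x]])
  moreover have "R ((T h x - x) /\<^sub>R h) = (T h (R x) - R x) /\<^sub>R h" if "h > 0" for h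
    using that linear_diff[OF bounded_linear.linear[OF R]]
    by (simp add: comm linear_cmul[OF bounded_linear.linear[OF R]])
  ultimately have "((\<lambda>h. (T h (R x) - R x) /\<^sub>R h) \<longlongrightarrow> R (generator T x)) (at_right 0)"
    by (rule tendsto_at_right_transform)
  from generatorI[of T "R x", OF this] show "R x \<in> generator_dom T" "generator T (R x) = R (generator T x)" .
qed

lemma J_of_generator:
  assumes "a \<ge> 0" "x \<in> generator_dom T"
  shows "J a (generator T x) = T a x - x"
  using bounded_commuting_generator(2)[of "J a" x] J_generator(2)[of a x] assms
  by (simp add: T_J_commute bounded_clinear_imp_bounded_linear J_clinear)

text \<open>If \<open>1 - T a\<close> is invertible then \<open>- (1 - T a)\<inverse> \<integral>\<^sub>0\<^sup>a T\<close> inverts the generator.\<close>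

lemma generator_invertible:
  assumes a: "a \<ge> 0" and 1: "1 \<in> resolvent_set UNIV (T a)"
  shows "0 \<in> resolvent_set (generator_dom T) (generator T)"
proof -
  obtain R where R: "bounded_clinear R" "\<And>y. R y - T a (R y) = y" "\<And>x. R (x - T a x) = x"
    using 1 by (auto simp: resolvent_set_def scaleC_one)
  note Rlin = bounded_clinear_imp_bounded_linear[OF R(1)]
  \<comment> \<open>\<open>T h\<close> commutes with \<open>1 - T a\<close>, hence also with its
    inverse \<open>R\<close>.\<close>
  have comm: "T h (R y) = R (T h y)" if "h \<ge> 0" for h y
  proof -
    have "T h (R y) = R (T h (R y) - T a (T h (R y)))" by (simp add: R)
    also have "T h (R y) - T a (T h (R y)) = T h (R y - T a (R y))"
      using that a by (simp add: commute[of a h] linear_diff[OF bounded_linear.linear, OF blinear])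
    finally show ?thesis by (simp add: R)
  qed
  \<comment> \<open>The resolvent at 0 inverts \<open>- generator T\<close>, so it is
    \<open>R (J a y)\<close> without a minus sign.\<close>
  have "R (J a y) \<in> generator_dom T \<and> 0 *\<^sub>C R (J a y) - generator T (R (J a y)) = y" for y
  proof -
    have "generator T (R (J a y)) = R (T a y - y)"
      using bounded_commuting_generator(2)[OF Rlin comm J_generator(1)[OF a]] J_generator(2)[OF a]
      by simp
    also have "\<dots> = - R (y - T a y)" by (simp flip: linear_neg[OF bounded_linear.linear, OF Rlin])
    finally show ?thesis
      using bounded_commuting_generator(1)[OF Rlin comm J_generator(1)[OF a]]
      by (simp add: R scaleC_zero_left)
  qed
  moreover have "R (J a (0 *\<^sub>C x - generator T x)) = x" if "x \<in> generator_dom T" for x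
  proof -
    have "R (J a (0 *\<^sub>C x - generator T x)) = R (x - T a x)"
      using J_of_generator[OF a that] linear_neg[OF bounded_linear.linear, OF bounded_clinear_imp_bounded_linear[OF J_clinear[OF a]]]
      by (simp add: scaleC_zero_left)
    then show ?thesis by (simp add: R)
  qed
  moreover have "bounded_clinear (\<lambda>y. R (J a y))"
    by (rule bounded_clinear_compose[OF R(1) J_clinear[OF a]])
  ultimately show ?thesis unfolding resolvent_set_def mem_Collect_eq by blast
qed

end

section \<open>Curves in \<open>C\<^sub>0(\<real>, X)\<close>\<close>

lemma bounded_linear_apply_c0: "bounded_linear (\<lambda>u. apply_c0 u s)"
  by (rule bounded_linear_intro[of _ 1]) (auto simp: norm_apply_c0_le)

text \<open>Evaluation is jointly continuous: the sup-norm controls the change of the function at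
  all points at once, and the limit function is continuous.\<close>

lemma tendsto_apply_c0:
  assumes f: "(f \<longlongrightarrow> u) F" and g: "(g \<longlongrightarrow> s) F"
  shows "((\<lambda>x. apply_c0 (f x) (g x)) \<longlongrightarrow> apply_c0 u s) F"
proof -
  have "((\<lambda>x. norm (f x - u)) \<longlongrightarrow> 0) F"
    using f by (simp add: tendsto_norm_zero LIM_zero)
  then have "((\<lambda>x. apply_c0 (f x - u) (g x)) \<longlongrightarrow> 0) F"
    by (rule Lim_null_comparison[rotated]) (simp add: norm_apply_c0_le del: apply_c0_minus)
  moreover have "isCont (apply_c0 u) s"
    using c0_cont[of u] by (simp add: continuous_on_eq_continuous_at)
  then have "((\<lambda>x. apply_c0 u (g x)) \<longlongrightarrow> apply_c0 u s) F"
    by (rule isCont_tendsto_compose[OF _ g])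
  ultimately have "((\<lambda>x. apply_c0 (f x - u) (g x) + apply_c0 u (g x)) \<longlongrightarrow> 0 + apply_c0 u s) F"
    by (rule tendsto_add)
  then show ?thesis by simp
qed

lemma continuous_on_apply_c0:
  "continuous_on A f \<Longrightarrow> continuous_on A g \<Longrightarrow> continuous_on A (\<lambda>x. apply_c0 (f x) (g x))"
  unfolding continuous_on_def by (auto intro: tendsto_apply_c0)

text \<open>A finite net of radius \<open>e/2\<close> reduces the claim to finitely many
  functions.\<close>

lemma compact_c0_uniform_decay:
  assumes "compact K" "e > 0"
  shows "\<forall>\<^sub>F s in at_infinity. \<forall>u\<in>K. norm (apply_c0 u s) < e"
proof -
  obtain k where k: "finite k" "K \<subseteq> (\<Union>x\<in>k. ball x (e/2))"
    by (rule compactE_image[OF \<open>compact K\<close>, of K "\<lambda>x. ball x (e/2)"]) (use \<open>e > 0\<close> in auto)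
  have "\<forall>\<^sub>F s in at_infinity. \<forall>x\<in>k. norm (apply_c0 x s) < e/2"
    using k(1) tendstoD[OF c0_lim, of "e/2"] \<open>e > 0\<close>
    by (intro eventually_ball_finite) auto
  then show ?thesis
  proof eventually_elim
    case (elim s)
    show ?case
    proof
      fix u assume "u \<in> K"
      then obtain x where x: "x \<in> k" "norm (u - x) < e/2"
        using k(2) by (auto simp: dist_norm norm_minus_commute)
      have "norm (apply_c0 u s) \<le> norm (apply_c0 (u - x) s) + norm (apply_c0 x s)"
        using norm_triangle_ineq[of "apply_c0 (u - x) s" "apply_c0 x s"] by simp
      also have "\<dots> < e"
        using x elim norm_apply_c0_le[of "u - x" s] by fastforce
      finally show "norm (apply_c0 u s) < e" .
    qed
  qed
qed

text \<open>Passes from pointwise to sup-norm continuity: on \<open>{-b..b}\<close> by uniform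
  continuity on a compact set, and outside it because both functions are small there by uniform
  decay.\<close>

lemma continuous_on_c0I:
  fixes F :: "real \<Rightarrow> 'a::real_normed_vector c0"
  assumes "compact C"
    and cont: "continuous_on (C \<times> UNIV) (\<lambda>(c, s). apply_c0 (F c) s)"
    and decay: "\<And>e. e > 0 \<Longrightarrow> \<forall>\<^sub>F s in at_infinity. \<forall>c\<in>C. norm (apply_c0 (F c) s) < e"
  shows "continuous_on C F"
  unfolding continuous_on_iff
proof (intro ballI allI impI)
  fix c e :: real assume c: "c \<in> C" and e: "e > 0"
  obtain b where b: "\<And>s c. b \<le> norm s \<Longrightarrow> c \<in> C \<Longrightarrow> norm (apply_c0 (F c) s) < e/4"
    using decay[of "e/4"] e unfolding eventually_at_infinity by force
  have "uniformly_continuous_on (C \<times> {-b..b}) (\<lambda>(c, s). apply_c0 (F c) s)"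
    by (intro compact_uniformly_continuous compact_Times \<open>compact C\<close> continuous_on_subset[OF cont]) auto
  then obtain d where d: "d > 0" "\<And>c' s. c' \<in> C \<Longrightarrow> s \<in> {-b..b} \<Longrightarrow> dist c' c < d \<Longrightarrow>
      dist (apply_c0 (F c') s) (apply_c0 (F c) s) < e/2"
  proof (rule uniformly_continuous_onE[where \<epsilon> = "e/2"])
    fix d assume d: "d > 0" "\<And>x x'. x \<in> C \<times> {-b..b} \<Longrightarrow> x' \<in> C \<times> {-b..b} \<Longrightarrow> dist x' x < d \<Longrightarrow>
      dist ((\<lambda>(c, s). apply_c0 (F c) s) x') ((\<lambda>(c, s). apply_c0 (F c) s) x) < e/2"
    show thesis
      by (rule that[of d]) (use c d(1) d(2)[of "(c, s)" "(c', s)" for c' s] in \<open>auto simp: dist_Pair_Pair\<close>)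
  qed (use e in auto)
  have "dist (F c') (F c) < e" if c': "c' \<in> C" "dist c' c < d" for c'
  proof -
    have "norm (apply_c0 (F c' - F c) s) \<le> e/2" for s
    proof (cases "s \<in> {-b..b}")
      case True
      then show ?thesis using d(2)[OF c'(1) True c'(2)] by (simp add: dist_norm)
    next
      case False
      then have "b \<le> norm s" by auto
      then show ?thesis
        using b[of s c] b[of s c'] c c' norm_triangle_ineq4[of "apply_c0 (F c') s" "apply_c0 (F c) s"]
        by simp
    qed
    then have "norm (F c' - F c) \<le> e/2" by (rule norm_c0_le)
    then show ?thesis using e by (simp add: dist_norm)
  qed
  then show "\<exists>d>0. \<forall>x'\<in>C. dist x' c < d \<longrightarrow> dist (F x') (F c) < e" using d(1) by blast
qed

section \<open>Periodic curves\<close>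

text \<open>For \<open>p > 0\<close>, the representative of \<open>r\<close> modulo \<open>p\<close>
  in the half-open interval from 0 to \<open>p\<close>.\<close>

definition pmod :: "real \<Rightarrow> real \<Rightarrow> real" where "pmod p r = r - p * of_int \<lfloor>r / p\<rfloor>"

lemma pmod_bounds: "p > 0 \<Longrightarrow> 0 \<le> pmod p r" "p > 0 \<Longrightarrow> pmod p r < p"
  using floor_divide_lower[of p r] floor_divide_upper[of p r]
  by (simp_all add: pmod_def algebra_simps)

lemma pmod_eqI:
  assumes "p > 0" "p * of_int k \<le> r" "r < p * (of_int k + 1)"
  shows "pmod p r = r - p * of_int k"
proof -
  have "\<lfloor>r / p\<rfloor> = k"
    using assms by (intro floor_unique) (simp_all add: field_simps)
  then show ?thesis by (simp add: pmod_def)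
qed

lemma pmod_add: "p > 0 \<Longrightarrow> pmod p (r + p) = pmod p r"
  by (simp add: pmod_def add_divide_distrib algebra_simps)

lemma periodic_eq_pmod:
  assumes "\<And>r. f (r + p) = f r"
  shows "f (pmod p r) = f r"
proof -
  have nat: "f (r + p * real n) = f r" for n r
  proof (induction n)
    case (Suc n)
    have "f (r + p * real (Suc n)) = f ((r + p * real n) + p)" by (simp add: algebra_simps)
    then show ?case using Suc by (simp only: assms)
  qed simp
  have "f (r + p * of_int k) = f r" for k r
  proof (cases k)
    case (nonneg n) then show ?thesis using nat[of r n] by simp
  next
    \<comment> \<open>For negative \<open>k\<close>, \<open>Suc n\<close> periods upwards from
      \<open>r + p * k\<close> lead back to \<open>r\<close>.\<close>
    case (neg n)
    then have k: "real_of_int k + real (Suc n) = 0" by simp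
    have "r + p * of_int k + p * real (Suc n) = r + p * (of_int k + real (Suc n))"
      by (simp only: distrib_left add.assoc)
    also have "\<dots> = r" unfolding k by simp
    finally have "r + p * of_int k + p * real (Suc n) = r" .
    with nat[of "r + p * of_int k" "Suc n"] show ?thesis by (simp only:)
  qed
  from this[of r "- \<lfloor>r / p\<rfloor>"] show ?thesis by (simp add: pmod_def)
qed

lemma compact_range_periodic:
  fixes f :: "real \<Rightarrow> 'a::topological_space"
  assumes "continuous_on UNIV f" "p > 0" "\<And>r. f (r + p) = f r"
  shows "compact (range f)"
proof -
  have "f r \<in> f ` {0..p}" for r
    using periodic_eq_pmod[of f p r, OF assms(3)] pmod_bounds[OF assms(2), of r]
    by (intro image_eqI[of _ _ "pmod p r"]) auto
  then have "range f = f ` {0..p}" by auto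
  then show ?thesis
    using compact_continuous_image[OF continuous_on_subset[OF assms(1)]] by auto
qed

text \<open>\<open>pmod\<close> jumps at multiples of \<open>p\<close>, so continuity there comes
  from gluing two neighbouring copies of \<open>h\<close>, which agree at the junction because
  \<open>h 0 = h p\<close>.\<close>

lemma continuous_on_periodic_extension:
  fixes h :: "real \<Rightarrow> 'a::topological_space"
  assumes h: "continuous_on {0..p} h" and p: "p > 0" and eq: "h 0 = h p"
  shows "continuous_on UNIV (\<lambda>r. h (pmod p r))"
proof -
  have "isCont (\<lambda>r. h (pmod p r)) r" for r
  proof -
    define k where "k = \<lfloor>r / p\<rfloor>"
    \<comment> \<open>The left end of the cell before the one containing \<open>r\<close>; thus
      \<open>r\<close> is interior to the two cells from \<open>a\<close> to
      \<open>a + 2 * p\<close>.\<close>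
    define a where "a = p * (of_int k - 1)"
    have ar: "a < r" "r < a + 2 * p"
      using floor_divide_lower[OF p, of r] floor_divide_upper[OF p, of r] p
      by (auto simp: a_def k_def algebra_simps)
    have "continuous_on ({a..a + p} \<union> {a + p..a + 2 * p})
        (\<lambda>r. if r \<le> a + p then h (r - a) else h (r - (a + p)))"
      by (rule continuous_on_If)
        (auto intro!: continuous_on_compose2[OF h] continuous_intros simp: eq)
    then have "continuous_on {a<..<a + 2 * p} (\<lambda>r. if r \<le> a + p then h (r - a) else h (r - (a + p)))"
      by (rule continuous_on_subset) auto
    moreover have "(if r \<le> a + p then h (r - a) else h (r - (a + p))) = h (pmod p r)"
      if "r \<in> {a<..<a + 2 * p}" for r
    proof (cases "r < a + p")
      case True
      then have "pmod p r = r - a"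
        using that pmod_eqI[OF p, of "k - 1" r] by (simp add: a_def algebra_simps)
      then show ?thesis using True by simp
    next
      case False
      then have "pmod p r = r - (a + p)"
        using that pmod_eqI[OF p, of k r] by (simp add: a_def algebra_simps)
      then show ?thesis using False eq by (cases "r = a + p") auto
    qed
    ultimately have "continuous_on {a<..<a + 2 * p} (\<lambda>r. h (pmod p r))"
      by (subst (asm) continuous_on_cong) auto
    then show ?thesis using ar by (simp add: continuous_on_eq_continuous_at)
  qed
  then show ?thesis by (simp add: continuous_at_imp_continuous_on)
qed

text \<open>The function inside \<^term>\<open>Abs_c0\<close> need not vanish at infinity in general; for continuous
  periodic \<open>\<Psi>\<close> it does, since \<open>\<Psi>\<close> then has compact range.\<close>

definition diag_curve :: "(real \<Rightarrow> real) \<Rightarrow> (real \<Rightarrow> 'a::real_normed_vector c0) \<Rightarrow> real \<Rightarrow> 'a c0" where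
  "diag_curve \<mu> \<Psi> c = Abs_c0 (\<lambda>\<tau>. apply_c0 (\<Psi> (\<mu> \<tau> - c)) \<tau>)"

context
  fixes \<mu> :: "real \<Rightarrow> real" and \<Psi> :: "real \<Rightarrow> 'a::real_normed_vector c0" and p :: real
  assumes \<mu>: "continuous_on UNIV \<mu>" and \<Psi>: "continuous_on UNIV \<Psi>"
    and p: "p > 0" and per: "\<And>r. \<Psi> (r + p) = \<Psi> r"
begin

lemma diag_curve_decay:
  "e > 0 \<Longrightarrow> \<forall>\<^sub>F s in at_infinity. \<forall>r. norm (apply_c0 (\<Psi> r) s) < e"
  using compact_c0_uniform_decay[OF compact_range_periodic[OF \<Psi> p per]] by simp

lemma apply_diag_curve: "apply_c0 (diag_curve \<mu> \<Psi> c) s = apply_c0 (\<Psi> (\<mu> s - c)) s"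
proof -
  have "continuous_on UNIV (\<lambda>\<tau>. apply_c0 (\<Psi> (\<mu> \<tau> - c)) \<tau>)"
    by (intro continuous_on_apply_c0 continuous_on_compose2[OF \<Psi>] continuous_intros \<mu>) auto
  moreover have "((\<lambda>\<tau>. apply_c0 (\<Psi> (\<mu> \<tau> - c)) \<tau>) \<longlongrightarrow> 0) at_infinity"
  proof (rule tendstoI)
    fix e :: real assume "e > 0"
    from diag_curve_decay[OF this]
    show "\<forall>\<^sub>F \<tau> in at_infinity. dist (apply_c0 (\<Psi> (\<mu> \<tau> - c)) \<tau>) 0 < e"
      by eventually_elim simp
  qed
  ultimately show ?thesis unfolding diag_curve_def by (subst Abs_c0_inverse) auto
qed

lemma continuous_on_diag_curve: "continuous_on UNIV (diag_curve \<mu> \<Psi>)"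
proof -
  have "isCont (diag_curve \<mu> \<Psi>) c" for c
  proof -
    have "continuous_on {c-1..c+1} (diag_curve \<mu> \<Psi>)"
    proof (rule continuous_on_c0I)
      show "continuous_on ({c-1..c+1} \<times> UNIV) (\<lambda>(c, s). apply_c0 (diag_curve \<mu> \<Psi> c) s)"
        unfolding apply_diag_curve split_def
        by (intro continuous_on_apply_c0 continuous_on_compose2[OF \<Psi>] continuous_intros
            continuous_on_compose2[OF \<mu>]) auto
      show "\<forall>\<^sub>F s in at_infinity. \<forall>c\<in>{c-1..c+1}. norm (apply_c0 (diag_curve \<mu> \<Psi> c) s) < e"
        if "e > 0" for e
        using diag_curve_decay[OF that] by eventually_elim (simp add: apply_diag_curve)
    qed auto
    then show ?thesis by (rule continuous_on_interior) auto
  qed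
  then show ?thesis by (simp add: continuous_at_imp_continuous_on)
qed

lemma diag_curve_periodic: "diag_curve \<mu> \<Psi> (c + p) = diag_curve \<mu> \<Psi> c"
  using per[of "\<mu> s - (c + p)" for s] by (intro c0_eqI) (simp add: apply_diag_curve algebra_simps)

end

section \<open>The generalized evolution semigroup\<close>

locale gen_evolution =
  fixes U :: "real \<Rightarrow> real \<Rightarrow> 'x::complex_banach \<Rightarrow> 'x" and \<mu> :: "real \<Rightarrow> real" and \<alpha> K :: real
  assumes \<mu>: "\<mu> \<in> A_infinity" and U: "evolution_family U"
    and bd: "\<forall>s \<tau>. \<tau> \<le> s \<longrightarrow> onorm (U s \<tau>) \<le> K * exp (\<alpha> * (\<mu> s - \<mu> \<tau>))"
begin

definition T :: "real \<Rightarrow> 'x c0 \<Rightarrow> 'x c0" where "T = gen_evolution_semigroup U \<mu>"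

definition pull :: "real \<Rightarrow> real \<Rightarrow> real" where "pull t s = inv \<mu> (\<mu> s - t)"

lemma mu_cont: "continuous_on UNIV \<mu>" and mu_mono: "strict_mono \<mu>"
  using \<mu> by (auto simp: A_infinity_def)

lemma mu_inv [simp]: "\<mu> (inv \<mu> x) = x" "inv \<mu> (\<mu> x) = x"
  using A_infinity_bij[OF \<mu>] by (simp_all add: bij_is_surj surj_f_inv_f bij_is_inj inv_f_f)

lemma inv_cont: "continuous_on UNIV (inv \<mu>)"
proof (rule continuous_at_imp_continuous_on, rule)
  fix x
  have "isCont (inv \<mu>) (\<mu> (inv \<mu> x))"
    by (rule isCont_inverse_function[of 1])
      (use mu_cont in \<open>auto simp: continuous_on_eq_continuous_at simp del: mu_inv(1)\<close>)
  then show "isCont (inv \<mu>) x" by simp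
qed

lemma mu_pull [simp]: "\<mu> (pull t s) = \<mu> s - t"
  by (simp add: pull_def)

lemma mu_eq_iff: "\<mu> x = \<mu> y \<longleftrightarrow> x = y"
  using mu_mono by (simp add: strict_mono_eq)

lemma pull_0 [simp]: "pull 0 s = s"
  by (simp add: pull_def)

lemma pull_pull: "pull a (pull b s) = pull (b + a) s"
  by (rule iffD1[OF mu_eq_iff]) simp

lemma pull_le: "t \<ge> 0 \<Longrightarrow> pull t s \<le> s"
  using strict_mono_less_eq[OF mu_mono, of "pull t s" s] by simp

lemma T_apply: "t \<ge> 0 \<Longrightarrow> apply_c0 (T t u) s = U s (pull t s) (apply_c0 u (pull t s))"
  unfolding T_def pull_def by (rule apply_gen_evolution_semigroup[OF \<mu> U bd])

lemma U_clinear: "\<tau> \<le> s \<Longrightarrow> bounded_clinear (U s \<tau>)"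
  using U by (simp add: evolution_family_def)

lemma U_linear: "\<tau> \<le> s \<Longrightarrow> linear (U s \<tau>)"
  by (intro bounded_linear.linear bounded_clinear_imp_bounded_linear U_clinear)

lemma U_refl [simp]: "U t t x = x"
  using U by (simp add: evolution_family_def)

lemma U_comp: "r \<le> \<tau> \<Longrightarrow> \<tau> \<le> t \<Longrightarrow> U t \<tau> (U \<tau> r x) = U t r x"
  using U by (simp add: evolution_family_def fun_eq_iff)

lemma U_pull_bound:
  assumes "t \<ge> 0"
  shows "norm (U s (pull t s) x) \<le> K * exp (\<alpha> * t) * norm x"
proof -
  have "norm (U s (pull t s) x) \<le> onorm (U s (pull t s)) * norm x"
    by (intro onorm bounded_clinear_imp_bounded_linear U_clinear pull_le assms)
  also have "onorm (U s (pull t s)) \<le> K * exp (\<alpha> * t)"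
    using bd[rule_format, OF pull_le[OF assms, of s]] by simp
  finally show ?thesis by (simp add: mult_right_mono)
qed

lemma K_nonneg: "K \<ge> 0"
proof -
  have "0 \<le> onorm (U 0 0)"
    by (intro onorm_pos_le bounded_clinear_imp_bounded_linear U_clinear order_refl)
  also have "\<dots> \<le> K" using bd[rule_format, of 0 0] by simp
  finally show ?thesis .
qed

lemma T_zero: "T 0 u = u"
  by (rule c0_eqI) (simp add: T_apply)

lemma T_add:
  assumes "a \<ge> 0" "b \<ge> 0"
  shows "T (a + b) u = T a (T b u)"
proof (rule c0_eqI)
  fix s
  have "pull (a + b) s \<le> pull a s" "pull a s \<le> s"
    using pull_le[OF assms(2), of "pull a s"] pull_le[OF assms(1), of s] by (simp_all add: pull_pull)
  then show "apply_c0 (T (a + b) u) s = apply_c0 (T a (T b u)) s"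
    using assms by (simp add: T_apply pull_pull U_comp)
qed

lemma T_bound:
  assumes "t \<ge> 0"
  shows "norm (T t u) \<le> K * exp (\<alpha> * t) * norm u"
proof (rule norm_c0_le)
  fix s
  have "norm (apply_c0 (T t u) s) \<le> K * exp (\<alpha> * t) * norm (apply_c0 u (pull t s))"
    using assms by (simp add: T_apply U_pull_bound)
  also have "\<dots> \<le> K * exp (\<alpha> * t) * norm u"
    using K_nonneg by (intro mult_left_mono norm_apply_c0_le) auto
  finally show "norm (apply_c0 (T t u) s) \<le> K * exp (\<alpha> * t) * norm u" .
qed

lemma T_clinear:
  assumes "t \<ge> 0"
  shows "bounded_clinear (T t)"
proof (rule bounded_clinearI[OF _ _ T_bound[OF assms]])
  show "T t (x + y) = T t x + T t y" for x y
    using assms by (intro c0_eqI) (simp add: T_apply linear_add[OF U_linear] pull_le)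
  show "T t (c *\<^sub>C x) = c *\<^sub>C T t x" for c x
    using assms by (intro c0_eqI) (simp add: T_apply bounded_clinear_scaleC[OF U_clinear] pull_le)
qed

section \<open>Strong continuity of the generalized evolution semigroup\<close>

lemma pull_cont:
  assumes "continuous_on A f" "continuous_on A g"
  shows "continuous_on A (\<lambda>x. pull (f x) (g x))"
  unfolding pull_def
  by (intro continuous_on_compose2[OF inv_cont] continuous_intros continuous_on_compose2[OF mu_cont] assms) auto

lemma exp_bound: "0 \<le> t \<Longrightarrow> t \<le> a \<Longrightarrow> K * exp (\<alpha> * t) \<le> K * exp (\<bar>\<alpha>\<bar> * a)"
  using K_nonneg by (intro mult_left_mono) (auto intro!: mult_mono)

text \<open>Strong continuity of \<open>U\<close> concerns a fixed vector. The vector is therefore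
  frozen at its value for \<open>q\<close>, and the error is controlled by the bound on
  \<open>U\<close>, uniform for \<open>t\<close> in \<open>{0..a}\<close>.\<close>

lemma T_joint_cont: "continuous_on ({0..a} \<times> UNIV) (\<lambda>(t, s). apply_c0 (T t u) s)"
proof -
  let ?A = "{0..a} \<times> (UNIV :: real set)"
  let ?b = "\<lambda>p. pull (fst p) (snd p)"
  have bc: "continuous_on ?A ?b" by (intro pull_cont continuous_intros)
  have "continuous_on ?A (\<lambda>p. U (snd p) (?b p) (apply_c0 u (?b p)))"
    unfolding continuous_on_def
  proof
    fix q assume q: "q \<in> ?A"
    have "continuous_on ?A (\<lambda>p. (\<lambda>(t, s). U t s (apply_c0 u (?b q))) (snd p, ?b p))"
      by (rule continuous_on_compose2[of "{(t, s). s \<le> t}"])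
        (use U in \<open>auto simp: evolution_family_def pull_le intro!: continuous_intros bc\<close>)
    from this[unfolded continuous_on_def, rule_format, OF q]
    have 1: "((\<lambda>p. U (snd p) (?b p) (apply_c0 u (?b q))) \<longlongrightarrow> U (snd q) (?b q) (apply_c0 u (?b q))) (at q within ?A)"
      by simp
    have "continuous_on ?A (\<lambda>p. apply_c0 u (?b p))"
      by (intro continuous_on_apply_c0 continuous_intros bc)
    from this[unfolded continuous_on_def, rule_format, OF q]
    have "((\<lambda>p. norm (apply_c0 u (?b p) - apply_c0 u (?b q))) \<longlongrightarrow> 0) (at q within ?A)"
      by (intro tendsto_norm_zero LIM_zero)
    then have 2: "((\<lambda>p. K * exp (\<bar>\<alpha>\<bar> * a) * norm (apply_c0 u (?b p) - apply_c0 u (?b q))) \<longlongrightarrow> 0) (at q within ?A)"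
      by (rule tendsto_mult_right_zero)
    have "((\<lambda>p. U (snd p) (?b p) (apply_c0 u (?b p) - apply_c0 u (?b q))) \<longlongrightarrow> 0) (at q within ?A)"
    proof (rule Lim_null_comparison[OF _ 2], unfold eventually_at_filter, intro always_eventually allI impI)
      fix p assume "p \<in> ?A"
      then have t: "0 \<le> fst p" "fst p \<le> a" by auto
      show "norm (U (snd p) (?b p) (apply_c0 u (?b p) - apply_c0 u (?b q))) \<le>
          K * exp (\<bar>\<alpha>\<bar> * a) * norm (apply_c0 u (?b p) - apply_c0 u (?b q))"
        by (rule order_trans[OF U_pull_bound[OF t(1)]]) (intro mult_right_mono exp_bound t, simp)
    qed
    from tendsto_add[OF this 1]
    have "((\<lambda>p. U (snd p) (?b p) (apply_c0 u (?b p) - apply_c0 u (?b q)) + U (snd p) (?b p) (apply_c0 u (?b q)))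
        \<longlongrightarrow> U (snd q) (?b q) (apply_c0 u (?b q))) (at q within ?A)" by simp
    then show "((\<lambda>p. U (snd p) (?b p) (apply_c0 u (?b p))) \<longlongrightarrow> U (snd q) (?b q) (apply_c0 u (?b q))) (at q within ?A)"
      by (rule Lim_transform_eventually)
        (auto simp: eventually_at_filter linear_diff[OF U_linear] pull_le intro!: always_eventually)
  qed
  then show ?thesis
    by (rule continuous_on_eq) (auto simp: T_apply)
qed

lemma T_decay:
  assumes "e > 0"
  shows "\<forall>\<^sub>F s in at_infinity. \<forall>t\<in>{0..a}. norm (apply_c0 (T t u) s) < e"
proof -
  define B where "B = K * exp (\<bar>\<alpha>\<bar> * a) + 1"
  have B: "B > 0" using K_nonneg by (simp add: B_def add_nonneg_pos)
  obtain r where r: "\<And>s. r \<le> \<bar>s\<bar> \<Longrightarrow> norm (apply_c0 u s) < e / B"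
    using tendstoD[OF c0_lim[of u], of "e / B"] assms B
    by (auto simp: eventually_at_infinity)
  \<comment> \<open>Pulling back moves points to the left: negative \<open>s\<close> only get
    further from 0, while positive \<open>s\<close> must be so large that a shift of the
    \<open>\<mu>\<close>-coordinate by \<open>a\<close> still leaves them beyond
    \<open>\<bar>r\<bar>\<close>.\<close>
  have "norm (apply_c0 (T t u) s) < e"
    if s: "max \<bar>r\<bar> \<bar>inv \<mu> (\<mu> \<bar>r\<bar> + a)\<bar> \<le> \<bar>s\<bar>" and t: "t \<in> {0..a}" for s t
  proof -
    have "r \<le> \<bar>pull t s\<bar>"
    proof (cases "s \<ge> 0")
      case True
      then have "inv \<mu> (\<mu> \<bar>r\<bar> + a) \<le> s" using s by auto
      then have "\<mu> \<bar>r\<bar> + a \<le> \<mu> s" using strict_mono_less_eq[OF mu_mono] mu_inv(1) by metis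
      then have "\<mu> \<bar>r\<bar> \<le> \<mu> (pull t s)" using t by simp
      then have "\<bar>r\<bar> \<le> pull t s" using strict_mono_less_eq[OF mu_mono] by blast
      then show ?thesis by simp
    next
      case False
      then show ?thesis using s t pull_le[of t s] by auto
    qed
    then have n: "norm (apply_c0 u (pull t s)) < e / B" by (rule r)
    have "norm (apply_c0 (T t u) s) \<le> K * exp (\<alpha> * t) * norm (apply_c0 u (pull t s))"
      using t by (simp add: T_apply U_pull_bound)
    also have "\<dots> \<le> B * norm (apply_c0 u (pull t s))"
      using exp_bound[of t a] t by (intro mult_right_mono) (auto simp: B_def)
    also have "\<dots> < B * (e / B)" using n B by (rule mult_strict_left_mono)
    finally show ?thesis using B by simp
  qed
  then show ?thesis unfolding eventually_at_infinity real_norm_def by blast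
qed

lemma T_cont: "continuous_on {0..} (\<lambda>t. T t u)"
  unfolding continuous_on_def
proof
  fix t :: real assume t: "t \<in> {0..}"
  have "continuous_on {0..t+1} (\<lambda>t. T t u)"
    by (intro continuous_on_c0I T_joint_cont T_decay compact_Icc)
  then have "((\<lambda>t. T t u) \<longlongrightarrow> T t u) (at t within {0..t+1})"
    using t by (simp add: continuous_on_def)
  moreover have "at t within {0..} = at t within {0..t+1}"
    by (rule at_within_nhd[of _ "{..<t+1}"]) auto
  ultimately show "((\<lambda>t. T t u) \<longlongrightarrow> T t u) (at t within {0..})" by simp
qed

sublocale c0_semigroup T K \<alpha>
  by unfold_locales (auto simp: T_zero T_add T_clinear T_bound T_cont)

text \<open>At \<open>s\<close>, \<open>T h\<close> reads its argument only at
  \<open>pull h s\<close>, where the diagonal curve takes the value of the single function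
  \<open>\<Psi> (\<mu> s - h - c)\<close>.\<close>

lemma T_diag_curve:
  assumes "continuous_on UNIV \<Psi>" "p > 0" "\<And>r. \<Psi> (r + p) = \<Psi> r" and h: "h \<ge> 0"
  shows "apply_c0 (T h (diag_curve \<mu> \<Psi> c)) s = apply_c0 (T h (\<Psi> (\<mu> s - c - h))) s"
  using h apply_diag_curve[OF mu_cont assms(1-3)] by (simp add: T_apply algebra_simps)

text \<open>A fixed vector \<open>x\<close> of \<open>T p\<close> is carried along its orbit to fixed vectors of the whole
  semigroup, one for each class modulo \<open>p\<close> of base points.\<close>

lemma fixed_vector_zero:
  assumes G: "0 \<in> resolvent_set (generator_dom T) (generator T)" and p: "p > 0"
    and x: "T p x = x"
  shows "x = 0"
proof (rule c0_eqI)
  fix s0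
  \<comment> \<open>The orbit of \<open>x\<close> closes up after time \<open>p\<close> since
    \<open>T p x = x\<close>, so it is continued as a continuous periodic curve.\<close>
  define \<Psi> where "\<Psi> r = T (pmod p r) x" for r
  have shift_nat: "T (p * real n + r) x = T r x" if "r \<ge> 0" for n r
  proof (induction n)
    case (Suc n)
    have "T (p * real (Suc n) + r) x = T (p * real n + r) (T p x)"
      using that p by (subst add[symmetric]) (simp_all add: algebra_simps)
    then show ?case using Suc x by simp
  qed simp
  have cont: "continuous_on UNIV \<Psi>"
    unfolding \<Psi>_def
    by (intro continuous_on_periodic_extension[of p "\<lambda>r. T r x"] p continuous_on_subset[OF T_cont])
      (auto simp: x zero)
  have per: "\<Psi> (r + p) = \<Psi> r" for r by (simp add: \<Psi>_def pmod_add p)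
  note \<Psi> = cont p per
  \<comment> \<open>\<open>h + pmod p (r - h)\<close> exceeds \<open>pmod p r\<close> by a
    nonnegative multiple of \<open>p\<close>, and \<open>x\<close> is fixed under that
    multiple.\<close>
  have shift: "T h (\<Psi> (r - h)) = \<Psi> r" if "h \<ge> 0" for h r
  proof -
    define n where "n = \<lfloor>r / p\<rfloor> - \<lfloor>(r - h) / p\<rfloor>"
    have "n \<ge> 0" unfolding n_def using that p by (simp add: floor_mono divide_right_mono)
    then have "h + pmod p (r - h) = p * real (nat n) + pmod p r"
      by (simp add: pmod_def n_def algebra_simps)
    then show ?thesis
      using shift_nat[of "pmod p r" "nat n"] that pmod_bounds(1)[OF p]
      by (simp add: \<Psi>_def add[symmetric])
  qed
  \<comment> \<open>By \<open>shift\<close>, \<open>u\<close> is fixed by every \<open>T h\<close>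
    and so lies in the kernel of the generator. The offset \<open>\<mu> s0\<close> makes
    \<open>u\<close> at \<open>s0\<close> equal to \<open>\<Psi> 0 = x\<close> there.\<close>
  define u where "u = diag_curve \<mu> \<Psi> (\<mu> s0)"
  have "T h u = u" if "h \<ge> 0" for h
    using that unfolding u_def
    by (intro c0_eqI) (simp add: T_diag_curve[OF \<Psi>] apply_diag_curve[OF mu_cont \<Psi>] shift)
  then have "((\<lambda>h. (T h u - u) /\<^sub>R h) \<longlongrightarrow> 0) (at_right 0)"
    by (intro tendsto_at_right_transform[OF tendsto_const]) simp
  from generatorI[of T u, OF this] have u: "u \<in> generator_dom T" "generator T u = 0" .
  obtain R where "bounded_clinear R" "\<And>x. x \<in> generator_dom T \<Longrightarrow> R (0 *\<^sub>C x - generator T x) = x"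
    using G by (auto simp: resolvent_set_def)
  from this(2)[OF u(1)] linear_0[OF bounded_linear.linear[OF bounded_clinear_imp_bounded_linear[OF this(1)]]]
  have "u = 0" by (simp add: u(2) scaleC_zero_left)
  then have "apply_c0 u s0 = 0" by simp
  moreover have "apply_c0 u s0 = apply_c0 x s0"
    using pmod_eqI[OF p, of 0 0] p by (simp add: u_def apply_diag_curve[OF mu_cont \<Psi>] \<Psi>_def zero)
  ultimately show "apply_c0 x s0 = apply_c0 0 s0" by simp
qed

end

section \<open>Solving \<open>x - T p x = g\<close> from invertibility of the generator\<close>

lemma norm_diag_curve_le:
  assumes "continuous_on UNIV \<mu>" "continuous_on UNIV \<Psi>" "p > 0" "\<And>r. \<Psi> (r + p) = \<Psi> r"
    and "\<And>r. norm (\<Psi> r) \<le> B"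
  shows "norm (diag_curve \<mu> \<Psi> c) \<le> B"
  by (rule norm_c0_le) (use apply_diag_curve[OF assms(1-4)] norm_apply_c0_le assms(5) order_trans in metis)

text \<open>An antiderivative is \<open>(3 * p * r^2 - 2 * r^3) / p^3\<close>; the factor
  \<open>6 / p^3\<close> normalizes the mass.\<close>

lemma has_integral_bump:
  assumes "p > 0"
  shows "((\<lambda>r. 6 * r * (p - r) / p ^ 3) has_integral (1 :: real)) {0..p}"
proof -
  have "((\<lambda>r. 6 * r * (p - r) / p ^ 3) has_integral
      (3 * p * p\<^sup>2 - 2 * p ^ 3) / p ^ 3 - (3 * p * 0\<^sup>2 - 2 * 0 ^ 3) / p ^ 3) {0..p}"
    using assms
    by (intro fundamental_theorem_of_calculus)
      (auto intro!: derivative_eq_intros simp: has_real_derivative_iff_has_vector_derivative[symmetric]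
        field_simps power2_eq_square power3_eq_cube)
  then show ?thesis using assms by (simp add: power2_eq_square power3_eq_cube)
qed

context gen_evolution
begin

text \<open>Spreading the datum \<open>g\<close> at the points \<open>\<mu> s \<equiv> c\<close> (modulo \<open>p\<close>) along its orbit with a bump
  of mass one yields \<open>f\<close>; a solution \<open>u\<close> of \<open>G u = - f\<close> then satisfies, at those points, the
  difference equation \<open>u = T p (u + g)\<close>. Gluing the values of these \<open>u\<close> over all \<open>c\<close> and adding
  \<open>g\<close> solves \<open>x - T p x = g\<close>.\<close>

lemma semigroup_invertible:
  assumes G: "0 \<in> resolvent_set (generator_dom T) (generator T)" and p: "p > 0"
  shows "1 \<in> resolvent_set UNIV (T p)"
proof -
  obtain R where R: "bounded_clinear R" "\<And>y. R y \<in> generator_dom T"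
    and GR: "\<And>y. 0 *\<^sub>C R y - generator T (R y) = y"
    using G by (auto simp: resolvent_set_def)
  have GR: "generator T (R y) = - y" for y
    using GR[of y] by (simp add: scaleC_zero_left minus_equation_iff)
  note Rlin = bounded_clinear_imp_bounded_linear[OF R(1)]
  obtain N where N: "N > 0" "\<And>y. norm (R y) \<le> norm y * N"
    using bounded_linear.pos_bounded[OF Rlin] by blast
  obtain B where B: "B > 0" "\<And>t x. 0 \<le> t \<Longrightarrow> t \<le> p \<Longrightarrow> norm (T t x) \<le> B * norm x"
    using local_bound[of p] p by (metis less_imp_le)
  define \<phi> where "\<phi> r = 6 * r * (p - r) / p ^ 3" for r
  have \<phi>_le: "\<bar>\<phi> r\<bar> \<le> 6 / p" if "0 \<le> r" "r \<le> p" for r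
  proof -
    have "r * (p - r) \<le> p * p" using that by (intro mult_mono) auto
    then have "\<phi> r \<le> 6 * (p * p) / p ^ 3"
      unfolding \<phi>_def using p by (intro divide_right_mono) auto
    then show ?thesis using that p by (simp add: \<phi>_def power3_eq_cube)
  qed
  \<comment> \<open>The constant collects the bounds \<open>6 / p\<close> of the bump,
    \<open>B\<close> of \<open>T\<close> on \<open>{0..p}\<close> and \<open>N\<close> of
    \<open>R\<close>; the 1 accounts for the summand \<open>g\<close> of \<open>x\<close>.\<close>
  have "\<exists>x. x - T p x = g \<and> norm x \<le> (6 / p * B * N + 1) * norm g" for g
  proof -
    define h where "h r = \<phi> r *\<^sub>R T r g" for r
    define \<Psi> where "\<Psi> r = h (pmod p r)" for r
    \<comment> \<open>The bump vanishes at both ends, so \<open>h\<close> extends to a continuous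
      periodic curve although \<open>T p g\<close> and \<open>g\<close> may differ.\<close>
    have h0: "h 0 = 0" "h p = 0" by (simp_all add: h_def \<phi>_def)
    have cont: "continuous_on UNIV \<Psi>"
      unfolding \<Psi>_def
    proof (rule continuous_on_periodic_extension)
      show "continuous_on {0..p} h"
        unfolding h_def \<phi>_def using p
        by (intro continuous_intros continuous_on_subset[OF T_cont]) auto
    qed (use p h0 in auto)
    have per: "\<Psi> (r + p) = \<Psi> r" for r by (simp add: \<Psi>_def pmod_add p)
    note \<Psi> = cont p per
    have \<Psi>_h: "\<Psi> r = h r" if "0 \<le> r" "r \<le> p" for r
    proof (cases "r = p")
      case True
      then show ?thesis using per[of 0] pmod_eqI[OF p, of 0 0] p h0 by (simp add: \<Psi>_def)
    next
      case False
      then show ?thesis using that pmod_eqI[OF p, of 0 r] by (simp add: \<Psi>_def)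
    qed
    have \<Psi>_le: "norm (\<Psi> r) \<le> 6 / p * (B * norm g)" for r
      unfolding \<Psi>_def h_def norm_scaleR
      by (intro mult_mono \<phi>_le B(2)) (use pmod_bounds[OF p, of r] p B(1) in auto)
    define f where "f = diag_curve \<mu> \<Psi>"
    define u where "u c = R (f c)" for c
    have u: "continuous_on UNIV u" "\<And>c. u (c + p) = u c"
      unfolding u_def f_def
      by (intro bounded_linear.continuous_on[OF Rlin] continuous_on_diag_curve[OF mu_cont \<Psi>])
        (simp add: diag_curve_periodic[OF mu_cont \<Psi>])
    have u_le: "norm (u c) \<le> 6 / p * (B * norm g) * N" for c
    proof -
      have "norm (u c) \<le> norm (f c) * N" unfolding u_def by (rule N)
      also have "\<dots> \<le> 6 / p * (B * norm g) * N"
        unfolding f_def using N(1) by (intro mult_right_mono norm_diag_curve_le[OF mu_cont \<Psi> \<Psi>_le]) auto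
      finally show ?thesis .
    qed
    define x where "x = diag_curve \<mu> u 0 + g"
    have "x - T p x = g"
    proof (rule c0_eqI)
      fix s
      \<comment> \<open>With this \<open>c\<close>, the equation at \<open>s\<close> involves only
        \<open>u c\<close>: \<open>x\<close> at \<open>s\<close> uses
        \<open>u (c + p) = u c\<close>, and \<open>T p x\<close> at \<open>s\<close> reads the
        diagonal curve where \<open>\<mu>\<close> equals \<open>c\<close>.\<close>
      define c where "c = \<mu> s - p"
      \<comment> \<open>Here \<open>\<Psi>\<close> is evaluated at \<open>p - r\<close>, and
        \<open>T r (T (p - r) g) = T p g\<close>: along the orbit ending at \<open>s\<close> only
        the scalar weight varies, and it integrates to 1.\<close>
      have "apply_c0 (T r (f c)) s = \<phi> (p - r) *\<^sub>R apply_c0 (T p g) s" if "r \<in> {0..p}" for r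
      proof -
        have "apply_c0 (T r (f c)) s = apply_c0 (T r (h (p - r))) s"
          using that by (simp add: f_def T_diag_curve[OF \<Psi>] c_def \<Psi>_h)
        also have "T r (h (p - r)) = \<phi> (p - r) *\<^sub>R T p g"
          using that by (simp add: h_def linear_cmul[OF bounded_linear.linear[OF blinear]] add[symmetric])
        finally show ?thesis by simp
      qed
      moreover have "((\<lambda>r. \<phi> (p - r) *\<^sub>R apply_c0 (T p g) s) has_integral 1 *\<^sub>R apply_c0 (T p g) s) {0..p}"
        using has_integral_bump[OF p]
        by (intro has_integral_scaleR_left) (simp add: \<phi>_def mult_ac)
      ultimately have "((\<lambda>r. apply_c0 (T r (f c)) s) has_integral apply_c0 (T p g) s) {0..p}"
        by (subst has_integral_cong) auto
      moreover have "((\<lambda>r. apply_c0 (T r (f c)) s) has_integral apply_c0 (J p (f c)) s) {0..p}"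
      proof -
        have "((\<lambda>r. T r (f c)) has_integral J p (f c)) {0..p}"
          unfolding J_def by (intro integrable_integral integrable order_refl)
        from has_integral_linear[OF this bounded_linear_apply_c0, of s] show ?thesis by (simp add: o_def)
      qed
      ultimately have J: "apply_c0 (J p (f c)) s = apply_c0 (T p g) s"
        by (rule has_integral_unique[symmetric])
      \<comment> \<open>Integrating the equation \<open>generator T (u c) = - f c\<close> over one
        period gives the difference equation.\<close>
      have "T p (u c) - u c = J p (- f c)"
        using J_of_generator[of p "u c"] p R(2) GR by (simp add: u_def)
      also have "\<dots> = - J p (f c)"
        using p linear_neg[OF bounded_linear.linear[OF bounded_clinear_imp_bounded_linear[OF J_clinear]]] by simp
      finally have "apply_c0 (T p (u c) - u c) s = - apply_c0 (T p g) s"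
        by (simp only: apply_c0_uminus J)
      moreover have "apply_c0 x s = apply_c0 (u c) s + apply_c0 g s"
        using u(2)[of c] by (simp add: x_def apply_diag_curve[OF mu_cont u(1) p u(2)] c_def)
      moreover have "apply_c0 (T p x) s = apply_c0 (T p (u c)) s + apply_c0 (T p g) s"
        using p linear_add[OF bounded_linear.linear[OF blinear]]
        by (simp add: x_def T_diag_curve[OF u(1) p u(2)] c_def)
      ultimately show "apply_c0 (x - T p x) s = apply_c0 g s" by (simp add: algebra_simps)
    qed
    moreover have "norm x \<le> 6 / p * (B * norm g) * N + norm g"
      unfolding x_def by (intro norm_triangle_le add_mono norm_diag_curve_le[OF mu_cont u(1) p u(2)] u_le) auto
    ultimately show ?thesis by (auto simp: algebra_simps)
  qed
  moreover have "bounded_clinear (\<lambda>x. x - T p x)"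
    using p T_clinear[of p] by (auto simp: bounded_clinear_def scaleC_diff_right intro: bounded_linear_sub bounded_linear_ident)
  moreover have "x = 0" if "x - T p x = 0" for x
    using fixed_vector_zero[OF G p, of x] that by simp
  ultimately obtain Q where Q: "bounded_clinear Q" "\<And>y. Q y - T p (Q y) = y" "\<And>x. Q (x - T p x) = x"
    using bounded_inverse_clinear[of "\<lambda>x. x - T p x"] by blast
  then show ?thesis unfolding resolvent_set_def by (auto simp: scaleC_one)
qed

section \<open>Rescaling, spectral mapping and invariance of the spectra\<close>

lemma gen_evolution_rescale:
  "gen_evolution (\<lambda>t s x. exp (- (w * complex_of_real (\<mu> t - \<mu> s))) *\<^sub>C U t s x) \<mu> (\<alpha> - Re w) K"
    (is "gen_evolution ?V _ _ _")
proof
  show "\<mu> \<in> A_infinity" by (rule \<mu>)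
  have "bounded_clinear (?V t s)" if "s \<le> t" for t s
    by (intro bounded_clinear_const_scaleC U_clinear that)
  moreover have "?V t t = id" for t by (simp add: fun_eq_iff scaleC_one)
  moreover have "?V t \<tau> \<circ> ?V \<tau> r = ?V t r" if "r \<le> \<tau>" "\<tau> \<le> t" for t \<tau> r
    using that
    by (simp add: fun_eq_iff bounded_clinear_scaleC[OF U_clinear] U_comp scaleC_scaleC algebra_simps flip: exp_add)
  moreover have "continuous_on {(t, s). s \<le> t} (\<lambda>(t, s). ?V t s x)" for x
    using U unfolding split_def evolution_family_def
    by (intro continuous_on_scaleC continuous_intros continuous_on_compose2[OF mu_cont]) auto
  ultimately show "evolution_family ?V" unfolding evolution_family_def by blast
  show "\<forall>s \<tau>. \<tau> \<le> s \<longrightarrow> onorm (?V s \<tau>) \<le> K * exp ((\<alpha> - Re w) * (\<mu> s - \<mu> \<tau>))"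
  proof (intro allI impI onorm_bound)
    fix s \<tau> :: real and x assume le: "\<tau> \<le> s"
    have "norm (U s \<tau> x) \<le> onorm (U s \<tau>) * norm x"
      by (intro onorm bounded_clinear_imp_bounded_linear U_clinear le)
    also have "\<dots> \<le> K * exp (\<alpha> * (\<mu> s - \<mu> \<tau>)) * norm x"
      using bd le by (intro mult_right_mono) auto
    finally have le: "exp (- Re w * (\<mu> s - \<mu> \<tau>)) * norm (U s \<tau> x) \<le>
        exp (- Re w * (\<mu> s - \<mu> \<tau>)) * (K * exp (\<alpha> * (\<mu> s - \<mu> \<tau>)) * norm x)"
      by (intro mult_left_mono) auto
    \<comment> \<open>The imaginary part of \<open>w\<close> drops out of the modulus, so the growth
      rate becomes \<open>\<alpha> - Re w\<close>.\<close>
    have "norm (?V s \<tau> x) = exp (- Re w * (\<mu> s - \<mu> \<tau>)) * norm (U s \<tau> x)"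
      by (simp add: norm_scaleC del: of_real_diff)
    also note le
    also have "exp (- Re w * (\<mu> s - \<mu> \<tau>)) * (K * exp (\<alpha> * (\<mu> s - \<mu> \<tau>)) * norm x) =
        K * exp ((\<alpha> - Re w) * (\<mu> s - \<mu> \<tau>)) * norm x"
    proof -
      have "exp ((\<alpha> - Re w) * (\<mu> s - \<mu> \<tau>)) =
          exp (- Re w * (\<mu> s - \<mu> \<tau>)) * exp (\<alpha> * (\<mu> s - \<mu> \<tau>))"
        by (subst exp_add[symmetric]) (simp add: algebra_simps)
      then show ?thesis by (simp only: mult_ac)
    qed
    finally show "norm (?V s \<tau> x) \<le> K * exp ((\<alpha> - Re w) * (\<mu> s - \<mu> \<tau>)) * norm x" .
  qed (use K_nonneg in auto)
qed

lemma exp_mem_resolvent_set_iff: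
  assumes p: "p > 0"
  shows "exp (complex_of_real p * w) \<in> resolvent_set UNIV (T p) \<longleftrightarrow>
    w \<in> resolvent_set (generator_dom T) (generator T)"
proof -
  interpret S: gen_evolution "\<lambda>t s x. exp (- (w * complex_of_real (\<mu> t - \<mu> s))) *\<^sub>C U t s x"
    \<mu> "\<alpha> - Re w" K
    by (rule gen_evolution_rescale)
  \<comment> \<open>Since \<open>\<mu> s - \<mu> (pull t s) = t\<close>, the weight does not depend
    on \<open>s\<close> and comes out as a scalar.\<close>
  have S: "S.T t x = exp (- (w * complex_of_real t)) *\<^sub>C T t x" if "t \<ge> 0" for t x
    using that by (intro c0_eqI) (simp add: S.T_apply T_apply del: of_real_diff)
  have Sp: "S.T p = (\<lambda>x. exp (- (w * complex_of_real p)) *\<^sub>C T p x)"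
    by (rule ext) (rule S[OF less_imp_le[OF p]])
  have 1: "exp (- (w * complex_of_real p)) * exp (complex_of_real p * w) = 1"
    by (simp add: mult.commute flip: exp_add)
  have "w \<in> resolvent_set (generator_dom T) (generator T) \<longleftrightarrow>
      0 \<in> resolvent_set (generator_dom T) (generator S.T)"
    using resolvent_set_shift[of "generator_dom T" "generator S.T" "generator T" w 0]
      generator_rescale(2)[of S.T w T, OF S] by simp
  also have "\<dots> \<longleftrightarrow> 0 \<in> resolvent_set (generator_dom S.T) (generator S.T)"
    using generator_rescale(1)[of S.T w T, OF S] by simp
  also have "\<dots> \<longleftrightarrow> 1 \<in> resolvent_set UNIV (S.T p)"
    using S.semigroup_invertible[OF _ p] S.generator_invertible[OF less_imp_le[OF p]] by blast
  also have "\<dots> \<longleftrightarrow> exp (- (w * p)) * exp (complex_of_real p * w) \<in> resolvent_set UNIV (\<lambda>x. exp (- (w * p)) *\<^sub>C T p x)"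
    unfolding Sp 1 ..
  also have "\<dots> \<longleftrightarrow> exp (complex_of_real p * w) \<in> resolvent_set UNIV (T p)"
    by (rule resolvent_set_scale) simp
  finally show ?thesis by simp
qed

lemma generator_spectrum_translate:
  "w + \<i> * complex_of_real r \<in> spectrum (generator_dom T) (generator T) \<longleftrightarrow>
    w \<in> spectrum (generator_dom T) (generator T)"
proof (cases "r = 0")
  case False
  \<comment> \<open>Chosen so that \<open>t * r\<close> is \<open>2 * pi\<close> up to sign:
    \<open>w\<close> and its translate then have the same exponential, and membership of either is
    decided by the same point for \<open>T t\<close>.\<close>
  define t where "t = 2 * pi / \<bar>r\<bar>"
  have t: "t > 0" using False by (simp add: t_def)
  have "t * r = 2 * pi \<or> t * r = - (2 * pi)"
    using False by (auto simp: t_def abs_if)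
  then have "exp (\<i> * complex_of_real (t * r)) = 1"
    by (auto simp: exp_eq_1 intro: exI[of _ 1] exI[of _ "-1"])
  then have "exp (complex_of_real t * (w + \<i> * complex_of_real r)) = exp (complex_of_real t * w)"
    by (simp add: distrib_left exp_add mult_ac)
  then show ?thesis
    unfolding spectrum_def using exp_mem_resolvent_set_iff[OF t] by (metis Compl_iff)
qed simp

lemma exp_mem_spectrum_iff:
  "p > 0 \<Longrightarrow> exp (complex_of_real p * w) \<in> spectrum UNIV (T p) \<longleftrightarrow>
    w \<in> spectrum (generator_dom T) (generator T)"
  by (simp add: spectrum_def exp_mem_resolvent_set_iff)

lemma semigroup_spectrum_rotate:
  assumes t: "t > 0" and c: "cmod c = 1"
  shows "c * z \<in> spectrum UNIV (T t) \<longleftrightarrow> z \<in> spectrum UNIV (T t)"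
proof (cases "z = 0")
  case False
  \<comment> \<open>Rotating \<open>z = exp (t * w)\<close> by the angle \<open>\<theta>\<close>
    amounts to translating \<open>w\<close> by \<open>\<i> * \<theta> / t\<close>.\<close>
  define w where "w = Ln z / complex_of_real t"
  have z: "z = exp (complex_of_real t * w)" using False t by (simp add: w_def)
  obtain \<theta> where \<theta>: "c = exp (\<i> * complex_of_real \<theta>)"
    using c complex_norm_eq_1_exp_eq[of c] by metis
  have cz: "c * z = exp (complex_of_real t * (w + \<i> * complex_of_real (\<theta> / t)))"
    using t unfolding z \<theta> by (simp add: distrib_left exp_add)
  show ?thesis
    unfolding cz exp_mem_spectrum_iff[OF t] generator_spectrum_translate
    unfolding z exp_mem_spectrum_iff[OF t] ..
qed simp

end

text \<open>At \<open>t = 0\<close> the identity on a nonzero space has spectrum \<open>{1}\<close>,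
  whereas the image of an empty \<open>\<sigma>\<^sub>G\<close> is empty; hence the proviso
  \<open>\<sigma>\<^sub>G \<noteq> {}\<close> for \<open>t = 0\<close>.\<close>

theorem corollary3p7:
  fixes U :: "real \<Rightarrow> real \<Rightarrow> 'x::complex_banach \<Rightarrow> 'x"
    and \<mu> :: "real \<Rightarrow> real" and \<alpha> K :: real
    and T :: "real \<Rightarrow> 'x c0 \<Rightarrow> 'x c0" and \<sigma>\<^sub>T :: "real \<Rightarrow> complex set" and \<sigma>\<^sub>G :: "complex set"
  assumes "\<mu> \<in> A_infinity"
    and "evolution_family U"
    and "\<alpha> > 0" and "K \<ge> 1"
    and "\<forall>s \<tau>. \<tau> \<le> s \<longrightarrow> onorm (U s \<tau>) \<le> K * exp (\<alpha> * (\<mu> s - \<mu> \<tau>))"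
    and "T = gen_evolution_semigroup U \<mu>"
    and "\<sigma>\<^sub>T = (\<lambda>t. spectrum UNIV (T t))"
    and "\<sigma>\<^sub>G = spectrum (generator_dom T) (generator T)"
  shows "(\<forall>t>0. \<forall>c. cmod c = 1 \<longrightarrow> (\<lambda>z. c * z) ` \<sigma>\<^sub>T t = \<sigma>\<^sub>T t) \<and>
    \<sigma>\<^sub>G = {z + \<i> * complex_of_real r | z r. z \<in> \<sigma>\<^sub>G} \<and>
    (\<forall>t\<ge>0. (t = 0 \<longrightarrow> \<sigma>\<^sub>G \<noteq> {}) \<longrightarrow>
       \<sigma>\<^sub>T t - {0} = (\<lambda>z. exp (complex_of_real t * z)) ` \<sigma>\<^sub>G) \<and>
    ((\<exists>t>0. \<sigma>\<^sub>T t \<inter> {z. cmod z = 1} = {}) \<longleftrightarrow>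
       (\<forall>t>0. \<sigma>\<^sub>T t \<inter> {z. cmod z = 1} = {})) \<and>
    ((\<exists>t>0. \<sigma>\<^sub>T t \<inter> {z. cmod z = 1} = {}) \<longleftrightarrow>
       0 \<in> resolvent_set (generator_dom T) (generator T))"
proof -
  interpret E: gen_evolution U \<mu> \<alpha> K
    by unfold_locales (fact assms)+
  have T: "T = E.T" by (simp add: E.T_def assms(6))
  have S: "\<sigma>\<^sub>T t = spectrum UNIV (E.T t)" for t by (simp add: assms(7) T)
  have G: "\<sigma>\<^sub>G = spectrum (generator_dom E.T) (generator E.T)" by (simp add: assms(8) T)
  have rot: "c * z \<in> \<sigma>\<^sub>T t \<longleftrightarrow> z \<in> \<sigma>\<^sub>T t" if "t > 0" "cmod c = 1" for c z t
    unfolding S by (rule E.semigroup_spectrum_rotate[OF that])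
  have 1: "(\<lambda>z. c * z) ` \<sigma>\<^sub>T t = \<sigma>\<^sub>T t" if "t > 0" "cmod c = 1" for c t
  proof (intro equalityI subsetI)
    fix z assume z: "z \<in> \<sigma>\<^sub>T t"
    have c: "c \<noteq> 0" using that by auto
    then have e: "c * (inverse c * z) = z" by simp
    have "inverse c * z \<in> \<sigma>\<^sub>T t"
      using rot[OF that, of "inverse c * z"] z unfolding e by simp
    then show "z \<in> (\<lambda>z. c * z) ` \<sigma>\<^sub>T t" using c by (intro image_eqI[of _ _ "inverse c * z"]) auto
  qed (use rot[OF that] in auto)
  have 2: "\<sigma>\<^sub>G = {z + \<i> * complex_of_real r | z r. z \<in> \<sigma>\<^sub>G}"
  proof (intro equalityI subsetI)
    fix z assume "z \<in> \<sigma>\<^sub>G"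
    then show "z \<in> {z + \<i> * complex_of_real r | z r. z \<in> \<sigma>\<^sub>G}"
      by (intro CollectI exI[of _ z] exI[of _ 0]) simp
  qed (auto simp: G E.generator_spectrum_translate)
  \<comment> \<open>Nonzero numbers are exactly the exponentials, with \<open>Ln z / t\<close> as
    preimage, so \<open>exp_mem_spectrum_iff\<close> decides both inclusions.\<close>
  have 3: "\<sigma>\<^sub>T t - {0} = (\<lambda>z. exp (complex_of_real t * z)) ` \<sigma>\<^sub>G" if t: "t > 0" for t
  proof (intro equalityI subsetI)
    fix z assume z: "z \<in> \<sigma>\<^sub>T t - {0}"
    then have "z = exp (complex_of_real t * (Ln z / complex_of_real t))" using t by simp
    then show "z \<in> (\<lambda>z. exp (complex_of_real t * z)) ` \<sigma>\<^sub>G"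
      using z E.exp_mem_spectrum_iff[OF t] unfolding S G by (metis DiffD1 image_eqI)
  qed (use E.exp_mem_spectrum_iff[OF t] in \<open>auto simp: S G\<close>)
  \<comment> \<open>\<open>T 0\<close> is the identity, so 1 can only be in its resolvent set if the
    space is zero; but then every number is in the resolvent set of the generator, contradicting
    \<open>ne\<close>.\<close>
  have 4: "\<sigma>\<^sub>T 0 - {0} = (\<lambda>z. exp (complex_of_real 0 * z)) ` \<sigma>\<^sub>G" if ne: "\<sigma>\<^sub>G \<noteq> {}"
  proof -
    have "1 \<in> spectrum UNIV (E.T 0)"
    proof (rule ccontr)
      assume "1 \<notin> spectrum UNIV (E.T 0)"
      then have 1: "1 \<in> resolvent_set UNIV (E.T 0)" by (simp add: spectrum_def)
      then have trivial: "x = y" for x y :: "'x c0"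
        by (auto simp: resolvent_set_def E.T_zero scaleC_one) (metis (full_types))
      \<comment> \<open>Only boundedness and values in the domain matter for \<open>R\<close>: all
        vectors coincide, so every required equation holds.\<close>
      obtain R :: "'x c0 \<Rightarrow> 'x c0" where R: "bounded_clinear R" "\<And>y. R y \<in> generator_dom E.T"
        using E.generator_invertible[OF order_refl 1] unfolding resolvent_set_def mem_Collect_eq by blast
      have "z \<in> resolvent_set (generator_dom E.T) (generator E.T)" for z
        unfolding resolvent_set_def
        by (intro CollectI exI[of _ R] conjI allI ballI R) (rule trivial)+
      then show False using ne by (auto simp: G spectrum_def)
    qed
    moreover have "z \<in> resolvent_set UNIV (E.T 0)" if "z \<noteq> 1" for z
    proof -
      have "z *\<^sub>C x - E.T 0 x = (z - 1) *\<^sub>C x" for x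
        by (simp add: E.T_zero scaleC_diff_left scaleC_one)
      then show ?thesis
        unfolding resolvent_set_def using that
        by (auto intro!: exI[of _ "\<lambda>x. inverse (z - 1) *\<^sub>C x"] bounded_clinear_const_scaleC
            bounded_clinear_id simp: scaleC_scaleC scaleC_one)
    qed
    ultimately have "spectrum UNIV (E.T 0) = {1}" by (auto simp: spectrum_def)
    then show ?thesis using ne by (auto simp: S)
  qed
  have 5: "\<sigma>\<^sub>T t \<inter> {z. cmod z = 1} = {} \<longleftrightarrow> 0 \<in> resolvent_set (generator_dom T) (generator T)"
    if t: "t > 0" for t
  proof -
    have "0 \<in> resolvent_set (generator_dom T) (generator T) \<longleftrightarrow> 1 \<notin> \<sigma>\<^sub>T t"
      using E.exp_mem_resolvent_set_iff[OF t, of 0] by (simp add: T S spectrum_def)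
    \<comment> \<open>A spectral point on the unit circle can be rotated to 1, so the spectrum
      avoids the circle iff it avoids 1.\<close>
    moreover have "1 \<in> \<sigma>\<^sub>T t" if "c \<in> \<sigma>\<^sub>T t" "cmod c = 1" for c
      using rot[OF t that(2), of 1] that(1) by simp
    then have "\<sigma>\<^sub>T t \<inter> {z. cmod z = 1} = {} \<longleftrightarrow> 1 \<notin> \<sigma>\<^sub>T t"
      using norm_one by blast
    ultimately show ?thesis by simp
  qed
  show ?thesis
  proof (intro conjI)
    show "\<forall>t\<ge>0. (t = 0 \<longrightarrow> \<sigma>\<^sub>G \<noteq> {}) \<longrightarrow>
        \<sigma>\<^sub>T t - {0} = (\<lambda>z. exp (complex_of_real t * z)) ` \<sigma>\<^sub>G"
    proof (intro allI impI)
      fix t :: real assume "t \<ge> 0" "t = 0 \<longrightarrow> \<sigma>\<^sub>G \<noteq> {}"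
      then show "\<sigma>\<^sub>T t - {0} = (\<lambda>z. exp (complex_of_real t * z)) ` \<sigma>\<^sub>G"
        using 3[of t] 4 by (cases "t = 0") auto
    qed
    have "\<exists>t::real. t > 0" by (rule exI[of _ 1]) simp
    with 5 show "(\<exists>t>0. \<sigma>\<^sub>T t \<inter> {z. cmod z = 1} = {}) \<longleftrightarrow>
        (\<forall>t>0. \<sigma>\<^sub>T t \<inter> {z. cmod z = 1} = {})"
      and "(\<exists>t>0. \<sigma>\<^sub>T t \<inter> {z. cmod z = 1} = {}) \<longleftrightarrow>
        0 \<in> resolvent_set (generator_dom T) (generator T)" by blast+
  qed (use 1 2 in blast)+
qed

end
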